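(* For every $f\in L^2(I)$, problem $BEP_{2,\infty}$ has a unique solution $g_0$, and $\|g_0\|_{L^2(I)}\le\|f\|_{L^2(I)}$. Moreover $\|g_0\|_{L^\infty(J)}=1$ unless $f=g_{|_I}$ for some $g\in H^2$ with $\|g\|_{L^\infty(J)}<1$.
   Context: $\mathbb T$ is the unit circle, $\ell$ normalized Lebesgue measure. $I\subset\mathbb T$ measurable, $J=\mathbb T\setminus I$, $\ell(I)>0$, $\ell(J)>0$. For measurable $E\subset\mathbb T$, $\|h\|_{L^2(E)}=(\frac1{2\pi}\int_E|h(e^{i\theta})|^2d\theta)^{1/2}$. $H^2$ is the Hardy space, identified with the subspace of $L^2(\mathbb T)$ of functions with vanishing negative-index Fourier coefficients. Problem $BEP_{2,\infty}$: given $f\in L^2(I)$, find $g_0\in H^2$ with $|g_0|\le1$ a.e. on $J$ such that $\|f-g_0\|_{L^2(I)}=\min\{\|f-g\|_{L^2(I)}:\ g\in H^2,\ |g|\le 1\text{ a.e. on }J\}$. *)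

theory Defs
  imports "HOL-Analysis.Analysis"
begin

text \<open>The unit circle is parametrised by theta in [0, 2 pi); a function h on the circle
is represented as h :: real \<Rightarrow> complex, h(theta) standing for h(e^{i theta}).
Normalized Lebesgue measure is d theta / (2 pi).\<close>

definition circ :: "real set" where
  "circ = {0..<2*pi}"

definition L2_on :: "real set \<Rightarrow> (real \<Rightarrow> complex) \<Rightarrow> bool" where
  "L2_on E h \<longleftrightarrow> h \<in> borel_measurable (lebesgue_on E) \<and>
                  integrable (lebesgue_on E) (\<lambda>x. (cmod (h x))\<^sup>2)"

definition L2_norm :: "real set \<Rightarrow> (real \<Rightarrow> complex) \<Rightarrow> real" where
  "L2_norm E h = sqrt ((1 / (2*pi)) * integral\<^sup>L (lebesgue_on E) (\<lambda>x. (cmod (h x))\<^sup>2))"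

definition Linf_norm :: "real set \<Rightarrow> (real \<Rightarrow> complex) \<Rightarrow> ereal" where
  "Linf_norm E h = Inf {c :: ereal. AE x in lebesgue. x \<in> E \<longrightarrow> ereal (cmod (h x)) \<le> c}"

text \<open>Hardy space H^2: functions in L^2(circle) whose Fourier coefficients of negative
index vanish; the coefficient of index -n is (1/2pi) \<integral> g(theta) e^{i n theta} d theta.\<close>
definition H2 :: "(real \<Rightarrow> complex) \<Rightarrow> bool" where
  "H2 g \<longleftrightarrow> L2_on circ g \<and>
     (\<forall>n::nat. n \<ge> 1 \<longrightarrow>
        integral\<^sup>L (lebesgue_on circ) (\<lambda>t. g t * exp (\<i> * of_nat n * of_real t)) = 0)"

definition BEP_admissible :: "real set \<Rightarrow> (real \<Rightarrow> complex) \<Rightarrow> bool" where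
  "BEP_admissible J g \<longleftrightarrow> H2 g \<and> (AE x in lebesgue. x \<in> J \<longrightarrow> cmod (g x) \<le> 1)"

definition BEP_solution :: "real set \<Rightarrow> (real \<Rightarrow> complex) \<Rightarrow> (real \<Rightarrow> complex) \<Rightarrow> bool" where
  "BEP_solution I f g0 \<longleftrightarrow> BEP_admissible (circ - I) g0 \<and>
     (\<forall>g. BEP_admissible (circ - I) g \<longrightarrow>
        L2_norm I (\<lambda>x. f x - g0 x) \<le> L2_norm I (\<lambda>x. f x - g x))"

end

(* Existence: elements of almost minimal norm in the sets of near-minimizers form an L2 Cauchy
   sequence by the parallelogram law.  Uniqueness: two solutions agree on I by strict convexity,
   hence everywhere, since an H2 function vanishing on a set of positive measure is zero.  For that
   uniqueness theorem one may assume mean 1; an element phi of least norm among the H2 functions of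
   mean 1 vanishing on the set is orthogonal to e^{int} phi for n >= 1, so |phi|^2 has only one
   nonzero Fourier coefficient and is constant, hence zero, which contradicts mean 1.  If the
   constraint on J is not saturated, perturbing g0 by small multiples of e^{int}, n >= 0, shows that
   the conjugate of (f - g0) 1_I is in H2; it vanishes on J, so f = g0 on I. *)
theory Submission
  imports Defs
begin

section \<open>Square-integrable functions\<close>

text \<open>The objective sees only I: along a minimizing sequence the residuals converge on I, but
  on J nothing is known beyond the bound 1. Hence the second minimization, of the norm over the
  whole circle, among near-minimizers. Its a priori bound combines the objective on I with the
  constraint on J. Conditions holding almost everywhere survive the limit through pointwise
  convergence, conditions on coefficients through L2 convergence, so both are carried along.

  Mean 1 is reached by dividing out the lowest power of e^{it} in the Fourier series and rescaling.
  Orthogonality kills the coefficients of |phi|^2 on one side only; those on the other side are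
  their conjugates. Since |phi|^2 is merely integrable, its constancy rests on the uniqueness of
  Fourier coefficients in L1, proved here by Stone-Weierstrass approximation and inner regularity.

  The norm estimate is a first-variation argument along the admissible segment (1 - t) g0.\<close>

definition L2_sq :: "real set \<Rightarrow> (real \<Rightarrow> complex) \<Rightarrow> real" where
  "L2_sq E h = integral\<^sup>L (lebesgue_on E) (\<lambda>x. (cmod (h x))\<^sup>2)"

text \<open>Minimization does not see the square root or the factor 1/(2 pi), so all estimates are
  made for \<open>L2_sq\<close>, where they are quadratic identities.\<close>

lemma L2_norm_le_iff: "L2_norm E g \<le> L2_norm E h \<longleftrightarrow> L2_sq E g \<le> L2_sq E h"
  by (simp add: L2_norm_def L2_sq_def divide_le_cancel)

lemma L2_sq_nonneg [simp]: "0 \<le> L2_sq E h"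
  by (simp add: L2_sq_def)

lemma L2_on_measurable: "L2_on E h \<Longrightarrow> h \<in> borel_measurable (lebesgue_on E)"
  by (simp add: L2_on_def)

lemma L2_on_integrable: "L2_on E h \<Longrightarrow> integrable (lebesgue_on E) (\<lambda>x. (cmod (h x))\<^sup>2)"
  by (simp add: L2_on_def)

lemma L2_on_zero [simp]: "L2_on E (\<lambda>x. 0)"
  by (simp add: L2_on_def)

lemma L2_on_bound:
  assumes "g \<in> borel_measurable (lebesgue_on E)" and "L2_on E h"
    and "AE x in lebesgue_on E. cmod (g x) \<le> B * cmod (h x)"
  shows "L2_on E g"
  unfolding L2_on_def
proof (intro conjI)
  show "integrable (lebesgue_on E) (\<lambda>x. (cmod (g x))\<^sup>2)"
  proof (rule Bochner_Integration.integrable_bound)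
    show "integrable (lebesgue_on E) (\<lambda>x. B\<^sup>2 * (cmod (h x))\<^sup>2)"
      using assms(2) by (simp add: L2_on_def)
    show "AE x in lebesgue_on E. norm ((cmod (g x))\<^sup>2) \<le> norm (B\<^sup>2 * (cmod (h x))\<^sup>2)"
      using assms(3)
    proof eventually_elim
      case (elim x)
      then have "(cmod (g x))\<^sup>2 \<le> (B * cmod (h x))\<^sup>2"
        by (intro power_mono) auto
      then show ?case by (simp add: power_mult_distrib)
    qed
  qed (use assms(1) in measurable)
qed (fact assms(1))

lemma cmod_add_sq_le: "(cmod (a + b))\<^sup>2 \<le> 2 * (cmod a)\<^sup>2 + 2 * (cmod b)\<^sup>2"
proof -
  have "(cmod (a + b))\<^sup>2 + (cmod (a - b))\<^sup>2 = 2 * (cmod a)\<^sup>2 + 2 * (cmod b)\<^sup>2"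
    unfolding cmod_power2 by (simp add: power2_eq_square algebra_simps)
  then show ?thesis by (smt (verit) zero_le_power2)
qed

lemma L2_on_add:
  assumes "L2_on E g" "L2_on E h"
  shows "L2_on E (\<lambda>x. g x + h x)"
  unfolding L2_on_def
proof (intro conjI)
  note [measurable] = assms[THEN L2_on_measurable]
  show "(\<lambda>x. g x + h x) \<in> borel_measurable (lebesgue_on E)" by measurable
  show "integrable (lebesgue_on E) (\<lambda>x. (cmod (g x + h x))\<^sup>2)"
  proof (rule Bochner_Integration.integrable_bound)
    show "integrable (lebesgue_on E) (\<lambda>x. 2 * (cmod (g x))\<^sup>2 + 2 * (cmod (h x))\<^sup>2)"
      using assms by (simp add: L2_on_def)
  qed (auto simp: cmod_add_sq_le)
qed

lemma L2_on_mult: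
  assumes "L2_on E h" "b \<in> borel_measurable (lebesgue_on E)" "\<And>x. cmod (b x) \<le> B"
  shows "L2_on E (\<lambda>x. b x * h x)"
proof (rule L2_on_bound[OF _ assms(1)])
  show "(\<lambda>x. b x * h x) \<in> borel_measurable (lebesgue_on E)"
    using L2_on_measurable[OF assms(1)] assms(2) by measurable
  show "AE x in lebesgue_on E. cmod (b x * h x) \<le> B * cmod (h x)"
    using assms(3) by (auto simp: norm_mult intro!: mult_right_mono)
qed

lemma L2_on_cmult: "L2_on E h \<Longrightarrow> L2_on E (\<lambda>x. c * h x)"
  by (rule L2_on_mult[where B = "cmod c"]) auto

lemma L2_on_diff:
  assumes "L2_on E g" "L2_on E h"
  shows "L2_on E (\<lambda>x. g x - h x)"
  using L2_on_add[OF assms(1) L2_on_cmult[OF assms(2), of "-1"]] by simp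

lemma L2_on_cnj: "L2_on E h \<Longrightarrow> L2_on E (\<lambda>x. cnj (h x))"
  unfolding L2_on_def by (auto intro: measurable_compose[OF _ borel_measurable_continuous_onI[OF continuous_on_cnj[OF continuous_on_id]]])

lemma L2_on_const: "E \<in> lmeasurable \<Longrightarrow> L2_on E (\<lambda>x. c)"
  by (auto simp: L2_on_def finite_measure_lebesgue_on integrable_const finite_measure.integrable_const)

lemma L2_on_integrable_mult:
  assumes "L2_on E g" "L2_on E h"
  shows "integrable (lebesgue_on E) (\<lambda>x. g x * h x)"
proof (rule Bochner_Integration.integrable_bound)
  show "integrable (lebesgue_on E) (\<lambda>x. (cmod (g x))\<^sup>2 + (cmod (h x))\<^sup>2)"
    using assms by (simp add: L2_on_def)
  show "(\<lambda>x. g x * h x) \<in> borel_measurable (lebesgue_on E)"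
    using assms[THEN L2_on_measurable] by measurable
  have "a * b \<le> a\<^sup>2 + b\<^sup>2" if "a \<ge> 0" "b \<ge> 0" for a b :: real
    using sum_squares_bound[of a b] mult_nonneg_nonneg[OF that] by linarith
  then show "AE x in lebesgue_on E. norm (g x * h x) \<le> norm ((cmod (g x))\<^sup>2 + (cmod (h x))\<^sup>2)"
    by (auto simp: norm_mult)
qed

lemma L2_on_imp_integrable:
  assumes "E \<in> lmeasurable" "L2_on E g"
  shows "integrable (lebesgue_on E) g"
  using L2_on_integrable_mult[OF assms(2) L2_on_const[OF assms(1), of 1]] by simp

section \<open>Restriction to a subset and extension by zero\<close>

lemma integrable_lebesgue_on_subset:
  fixes h :: "'a::euclidean_space \<Rightarrow> 'b::{banach, second_countable_topology}"
  assumes "integrable (lebesgue_on F) h" "E \<subseteq> F" "E \<in> sets lebesgue" "F \<in> sets lebesgue"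
  shows "integrable (lebesgue_on E) h"
proof -
  have "integrable lebesgue (\<lambda>x. indicator E x *\<^sub>R indicator F x *\<^sub>R h x)"
    using assms by (intro integrable_mult_indicator[of E]) (auto simp: integrable_restrict_space)
  moreover have "indicator E x *\<^sub>R indicator F x *\<^sub>R h x = indicator E x *\<^sub>R h x" for x
    using assms(2) by (auto simp: indicator_def)
  ultimately show ?thesis using assms(3) by (simp add: integrable_restrict_space del: scaleR_scaleR)
qed

lemma L2_on_subset:
  assumes "L2_on F h" "E \<subseteq> F" "E \<in> sets lebesgue" "F \<in> sets lebesgue"
  shows "L2_on E h"
  unfolding L2_on_def
proof
  have "(\<lambda>x. if x \<in> E then h x else 0) \<in> borel_measurable (lebesgue_on F)"
  proof (rule measurable_If_set)
    show "E \<inter> space (lebesgue_on F) \<in> sets (lebesgue_on F)"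
      using assms by (simp add: sets_restrict_space_iff)
  qed (use L2_on_measurable[OF assms(1)] in auto)
  then show "h \<in> borel_measurable (lebesgue_on E)"
    using borel_measurable_if_lebesgue_on[OF assms(3,4,2)] by blast
  show "integrable (lebesgue_on E) (\<lambda>x. (cmod (h x))\<^sup>2)"
    using integrable_lebesgue_on_subset[OF L2_on_integrable[OF assms(1)] assms(2-4)] .
qed

lemma
  fixes h :: "'a::euclidean_space \<Rightarrow> 'b::{banach, second_countable_topology}"
  assumes "E \<subseteq> F" "E \<in> sets lebesgue" "F \<in> sets lebesgue"
  shows integrable_lebesgue_on_extend:
      "integrable (lebesgue_on F) (\<lambda>x. if x \<in> E then h x else 0) \<longleftrightarrow> integrable (lebesgue_on E) h"
    and integral_lebesgue_on_extend:
      "integral\<^sup>L (lebesgue_on F) (\<lambda>x. if x \<in> E then h x else 0) = integral\<^sup>L (lebesgue_on E) h"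
proof -
  have "indicator F x *\<^sub>R (if x \<in> E then h x else 0) = indicator E x *\<^sub>R h x" for x
    using assms(1) by (auto simp: indicator_def)
  then show "integrable (lebesgue_on F) (\<lambda>x. if x \<in> E then h x else 0) \<longleftrightarrow> integrable (lebesgue_on E) h"
    and "integral\<^sup>L (lebesgue_on F) (\<lambda>x. if x \<in> E then h x else 0) = integral\<^sup>L (lebesgue_on E) h"
    using assms by (simp_all add: integrable_restrict_space integral_restrict_space)
qed

lemma L2_on_extend:
  assumes "L2_on E h" "E \<subseteq> F" "E \<in> sets lebesgue" "F \<in> sets lebesgue"
  shows "L2_on F (\<lambda>x. if x \<in> E then h x else 0)"
  unfolding L2_on_def
proof
  show "(\<lambda>x. if x \<in> E then h x else 0) \<in> borel_measurable (lebesgue_on F)"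
    using borel_measurable_if_lebesgue_on[OF assms(3,4,2)] L2_on_measurable[OF assms(1)] by blast
  have "(cmod (if x \<in> E then h x else 0))\<^sup>2 = (if x \<in> E then (cmod (h x))\<^sup>2 else 0)" for x
    by simp
  then show "integrable (lebesgue_on F) (\<lambda>x. (cmod (if x \<in> E then h x else 0))\<^sup>2)"
    using integrable_lebesgue_on_extend[OF assms(2-4), of "\<lambda>x. (cmod (h x))\<^sup>2"] L2_on_integrable[OF assms(1)]
    by simp
qed

section \<open>The squared norm: parallelogram law, limits, completeness\<close>

lemma L2_sq_add:
  assumes "L2_on E g" "L2_on E h"
  shows "L2_sq E (\<lambda>x. g x + h x) =
    L2_sq E g + 2 * Re (integral\<^sup>L (lebesgue_on E) (\<lambda>x. g x * cnj (h x))) + L2_sq E h"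
proof -
  have i: "integrable (lebesgue_on E) (\<lambda>x. g x * cnj (h x))"
    using L2_on_integrable_mult[OF assms(1) L2_on_cnj[OF assms(2)]] .
  have "(cmod (g x + h x))\<^sup>2 = (cmod (g x))\<^sup>2 + 2 * Re (g x * cnj (h x)) + (cmod (h x))\<^sup>2" for x
    unfolding cmod_power2 by (simp add: power2_eq_square algebra_simps)
  then have "L2_sq E (\<lambda>x. g x + h x) = integral\<^sup>L (lebesgue_on E)
      (\<lambda>x. (cmod (g x))\<^sup>2 + 2 * Re (g x * cnj (h x)) + (cmod (h x))\<^sup>2)"
    by (simp add: L2_sq_def)
  also have "\<dots> = L2_sq E g + 2 * integral\<^sup>L (lebesgue_on E) (\<lambda>x. Re (g x * cnj (h x))) + L2_sq E h"
    using i assms[THEN L2_on_integrable] integrable_Re[OF i]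
    by (simp add: L2_sq_def del: integral_Re integrable_Re times_complex.sel)
  finally show ?thesis using integral_Re[OF i] by simp
qed

lemma L2_sq_cmult: "L2_sq E (\<lambda>x. c * h x) = (cmod c)\<^sup>2 * L2_sq E h"
  by (simp add: L2_sq_def norm_mult power_mult_distrib)

text \<open>The midpoint form fits sets closed under midpoints: if the midpoint is hardly better
  than the two points, their difference must be small.\<close>

lemma L2_sq_parallelogram:
  assumes "L2_on E g" "L2_on E h"
  shows "L2_sq E (\<lambda>x. g x - h x) + 4 * L2_sq E (\<lambda>x. (g x + h x) / 2) = 2 * L2_sq E g + 2 * L2_sq E h"
proof -
  have "L2_sq E (\<lambda>x. g x - h x) + L2_sq E (\<lambda>x. g x + h x) = 2 * L2_sq E g + 2 * L2_sq E h"
    using L2_sq_add[OF assms] L2_sq_add[OF assms(1) L2_on_cmult[OF assms(2), of "-1"]]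
      L2_sq_cmult[of E "-1" h] by simp
  moreover have "4 * L2_sq E (\<lambda>x. (g x + h x) / 2) = L2_sq E (\<lambda>x. g x + h x)"
    using L2_sq_cmult[of E "1/2" "\<lambda>x. g x + h x"] by (simp add: power2_eq_square)
  ultimately show ?thesis by simp
qed

lemma L2_sq_eq_0_iff:
  "L2_on E h \<Longrightarrow> L2_sq E h = 0 \<longleftrightarrow> (AE x in lebesgue_on E. h x = 0)"
  unfolding L2_sq_def using integral_nonneg_eq_0_iff_AE[OF L2_on_integrable] by simp

text \<open>Fatou's lemma. The bound may vary with n because minimizing sequences are only known to
  be within 1/(n+1) of the infimum; a constant bound is the case used for completeness.\<close>

lemma L2_fatou:
  assumes "\<And>n. L2_on E (g n)" "h \<in> borel_measurable (lebesgue_on E)"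
    and "AE x in lebesgue_on E. (\<lambda>n. g n x) \<longlonglongrightarrow> h x"
    and "\<And>n. L2_sq E (g n) \<le> c n" "c \<longlonglongrightarrow> C"
  shows "L2_on E h \<and> L2_sq E h \<le> C"
proof -
  let ?M = "lebesgue_on E"
  note [measurable] = assms(2) L2_on_measurable[OF assms(1)]
  have C: "C \<ge> 0"
    using LIMSEQ_le_const[OF assms(5), of 0] assms(4) L2_sq_nonneg by (metis order_trans)
  have "(\<integral>\<^sup>+x. ennreal ((cmod (h x))\<^sup>2) \<partial>?M) = (\<integral>\<^sup>+x. liminf (\<lambda>n. ennreal ((cmod (g n x))\<^sup>2)) \<partial>?M)"
  proof (rule nn_integral_cong_AE)
    show "AE x in ?M. ennreal ((cmod (h x))\<^sup>2) = liminf (\<lambda>n. ennreal ((cmod (g n x))\<^sup>2))"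
      using assms(3)
    proof eventually_elim
      case (elim x)
      then have "(\<lambda>n. ennreal ((cmod (g n x))\<^sup>2)) \<longlonglongrightarrow> ennreal ((cmod (h x))\<^sup>2)"
        by (intro tendsto_ennrealI tendsto_intros)
      then show ?case by (metis lim_imp_Liminf trivial_limit_sequentially)
    qed
  qed
  also have "\<dots> \<le> liminf (\<lambda>n. \<integral>\<^sup>+x. ennreal ((cmod (g n x))\<^sup>2) \<partial>?M)"
    by (rule nn_integral_liminf) measurable
  also have "\<dots> \<le> liminf (\<lambda>n. ennreal (c n))"
  proof (rule Liminf_mono, rule always_eventually, rule allI)
    fix n
    have "(\<integral>\<^sup>+x. ennreal ((cmod (g n x))\<^sup>2) \<partial>?M) = ennreal (L2_sq E (g n))"
      unfolding L2_sq_def by (rule nn_integral_eq_integral[OF L2_on_integrable[OF assms(1)]]) simp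
    then show "(\<integral>\<^sup>+x. ennreal ((cmod (g n x))\<^sup>2) \<partial>?M) \<le> ennreal (c n)"
      using assms(4) by (simp add: ennreal_leI)
  qed
  also have "\<dots> = ennreal C"
    using assms(5) by (intro lim_imp_Liminf tendsto_ennrealI) auto
  finally have le: "(\<integral>\<^sup>+x. ennreal ((cmod (h x))\<^sup>2) \<partial>?M) \<le> ennreal C" .
  then have int: "integrable ?M (\<lambda>x. (cmod (h x))\<^sup>2)"
    by (intro integrableI_nonneg) (auto intro: le_less_trans)
  then have "L2_on E h" using assms(2) by (simp add: L2_on_def)
  moreover have "ennreal (L2_sq E h) \<le> ennreal C"
    using le nn_integral_eq_integral[OF int] by (simp add: L2_sq_def)
  ultimately show ?thesis using C by (simp add: ennreal_le_iff)
qed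

text \<open>A form of Cauchy-Schwarz with a free weight, from a \<le> d + a^2/d. First d is chosen
  to make the first term small, then the L2 size is made small relative to d.\<close>

lemma L1_le_L2:
  assumes "E \<in> lmeasurable" "L2_on E h" "d > 0"
  shows "integral\<^sup>L (lebesgue_on E) (\<lambda>x. cmod (h x)) \<le> d * measure lebesgue E + L2_sq E h / d"
proof -
  have 1: "integrable (lebesgue_on E) (\<lambda>x. d)"
    using assms(1) by (simp add: finite_measure.integrable_const finite_measure_lebesgue_on)
  have "integral\<^sup>L (lebesgue_on E) (\<lambda>x. cmod (h x))
      \<le> integral\<^sup>L (lebesgue_on E) (\<lambda>x. d + (cmod (h x))\<^sup>2 / d)"
  proof (rule integral_mono)
    show "integrable (lebesgue_on E) (\<lambda>x. cmod (h x))"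
      using L2_on_imp_integrable[OF assms(1,2)] by simp
    show "integrable (lebesgue_on E) (\<lambda>x. d + (cmod (h x))\<^sup>2 / d)"
      using 1 L2_on_integrable[OF assms(2)] by simp
    show "cmod (h x) \<le> d + (cmod (h x))\<^sup>2 / d" for x
    proof -
      have "d * cmod (h x) \<le> d * d + (cmod (h x))\<^sup>2"
        using sum_squares_bound[of d "cmod (h x)"] mult_nonneg_nonneg[of d "cmod (h x)"] assms(3)
        unfolding power2_eq_square mult.assoc by (smt (verit) norm_ge_zero)
      then show ?thesis using assms(3) by (simp add: field_simps power2_eq_square)
    qed
  qed
  also have "\<dots> = d * measure lebesgue E + L2_sq E h / d"
    using 1 L2_on_integrable[OF assms(2)] assms(1)
    by (simp add: L2_sq_def measure_restrict_space fmeasurableD)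
  finally show ?thesis .
qed

text \<open>On a set of finite measure an L2 Cauchy sequence is L1 Cauchy, so a subsequence
  converges almost everywhere, and Fatou turns this limit into an L2 limit. The pointwise
  convergence is part of the conclusion because vanishing on a set and modulus at most 1 pass to the
  limit through it.\<close>

lemma L2_complete:
  assumes E: "E \<in> lmeasurable" and g: "\<And>n. L2_on E (g n)"
    and cau: "\<And>e. e > 0 \<Longrightarrow> \<exists>N. \<forall>m\<ge>N. \<forall>n\<ge>N. L2_sq E (\<lambda>x. g m x - g n x) \<le> e"
  obtains h r where "L2_on E h" "strict_mono (r :: nat \<Rightarrow> nat)"
    "AE x in lebesgue_on E. (\<lambda>n. g (r n) x) \<longlonglongrightarrow> h x"
    "(\<lambda>n. L2_sq E (\<lambda>x. g (r n) x - h x)) \<longlonglongrightarrow> 0"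
proof -
  let ?M = "lebesgue_on E"
  let ?m = "measure lebesgue E"
  have "\<exists>N. \<forall>i\<ge>N. \<forall>j\<ge>N. (LINT x|?M. norm (g i x - g j x)) < e" if e: "e > 0" for e
  proof -
    \<comment> \<open>The 3 leaves \<open>d * ?m\<close> strictly below e/2; the added 1 covers a
      set of measure zero.\<close>
    define d where "d = e / (3 * (?m + 1))"
    have d: "d > 0" "d * ?m < e / 2"
      using e by (auto simp: d_def field_simps add_pos_nonneg add_nonneg_pos intro!: divide_pos_pos)
    obtain N where N: "\<And>m n. m \<ge> N \<Longrightarrow> n \<ge> N \<Longrightarrow> L2_sq E (\<lambda>x. g m x - g n x) \<le> d * e / 2"
      using cau[of "d * e / 2"] d e by auto
    have "(LINT x|?M. norm (g i x - g j x)) < e" if "i \<ge> N" "j \<ge> N" for i j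
    proof -
      have "L2_sq E (\<lambda>x. g i x - g j x) / d \<le> e / 2"
        using N[OF that] d by (simp add: field_simps)
      then show ?thesis
        using L1_le_L2[OF E L2_on_diff[OF g g] d(1), of i j] d(2) by linarith
    qed
    then show ?thesis by blast
  qed
  then obtain r where r: "strict_mono r" "AE x in ?M. Cauchy (\<lambda>i. g (r i) x)"
    using cauchy_L1_AE_cauchy_subseq[of ?M g] L2_on_imp_integrable[OF E g] by blast
  define h where "h = (\<lambda>x. lim (\<lambda>i. g (r i) x))"
  note [measurable] = L2_on_measurable[OF g]
  have hm [measurable]: "h \<in> borel_measurable ?M"
    unfolding h_def by (rule borel_measurable_lim_metric) measurable
  have conv: "AE x in ?M. (\<lambda>n. g (r n) x) \<longlonglongrightarrow> h x"
    using r(2) by eventually_elim (simp add: h_def Cauchy_convergent_iff convergent_LIMSEQ_iff)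
  have close: "\<exists>N. \<forall>n\<ge>N. L2_on E (\<lambda>x. g (r n) x - h x) \<and> L2_sq E (\<lambda>x. g (r n) x - h x) \<le> e"
    if "e > 0" for e
  proof -
    obtain N where N: "\<And>m n. m \<ge> N \<Longrightarrow> n \<ge> N \<Longrightarrow> L2_sq E (\<lambda>x. g m x - g n x) \<le> e"
      using cau[OF \<open>e > 0\<close>] by blast
    have "L2_on E (\<lambda>x. g (r n) x - h x) \<and> L2_sq E (\<lambda>x. g (r n) x - h x) \<le> e" if n: "n \<ge> N" for n
    proof (rule L2_fatou)
      \<comment> \<open>Here n is fixed and k tends to infinity; since \<open>r (k + N)\<close> is
        at least \<open>k + N\<close>, the shift by N puts the second index in the Cauchy
        range.\<close>
      show "L2_on E (\<lambda>x. g (r n) x - g (r (k + N)) x)" for k by (intro L2_on_diff g)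
      show "AE x in ?M. (\<lambda>k. g (r n) x - g (r (k + N)) x) \<longlonglongrightarrow> g (r n) x - h x"
        using conv
      proof eventually_elim
        case (elim x)
        show ?case using LIMSEQ_ignore_initial_segment[OF elim, of N] by (intro tendsto_intros)
      qed
      show "L2_sq E (\<lambda>x. g (r n) x - g (r (k + N)) x) \<le> e" for k
        using n seq_suble[OF r(1)] by (intro N) (meson le_add2 le_trans)+
    qed auto
    then show ?thesis by blast
  qed
  obtain n where "L2_on E (\<lambda>x. g (r n) x - h x)" using close[of 1] by auto
  from L2_on_diff[OF g[of "r n"] this] have "L2_on E h" by simp
  moreover have "(\<lambda>n. L2_sq E (\<lambda>x. g (r n) x - h x)) \<longlonglongrightarrow> 0"
  proof (rule LIMSEQ_I)
    fix e :: real assume "e > 0"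
    then obtain N where "\<forall>n\<ge>N. L2_sq E (\<lambda>x. g (r n) x - h x) \<le> e / 2" using close[of "e/2"] by auto
    then show "\<exists>N. \<forall>n\<ge>N. norm (L2_sq E (\<lambda>x. g (r n) x - h x) - 0) < e"
      using \<open>e > 0\<close> by (intro exI[of _ N]) (auto intro: le_less_trans[of _ "e/2"])
  qed
  ultimately show ?thesis using that r(1) conv by blast
qed

text \<open>Continuity of the pairing with a fixed u, again by the weighted inequality ab \<le> d
  b^2 + a^2/d. Applied to exponentials, it makes Fourier coefficients continuous in L2.\<close>

lemma L2_tendsto_integral_mult:
  assumes g: "\<And>n. L2_on E (g n)" and h: "L2_on E h" and u: "L2_on E u"
    and lim: "(\<lambda>n. L2_sq E (\<lambda>x. g n x - h x)) \<longlonglongrightarrow> 0"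
  shows "(\<lambda>n. integral\<^sup>L (lebesgue_on E) (\<lambda>x. g n x * u x)) \<longlonglongrightarrow>
    integral\<^sup>L (lebesgue_on E) (\<lambda>x. h x * u x)"
proof -
  let ?M = "lebesgue_on E"
  have key: "cmod (integral\<^sup>L ?M (\<lambda>x. g n x * u x) - integral\<^sup>L ?M (\<lambda>x. h x * u x))
      \<le> d * L2_sq E u + L2_sq E (\<lambda>x. g n x - h x) / d" if d: "d > 0" for d n
  proof -
    let ?e = "\<lambda>x. g n x - h x"
    have e: "L2_on E ?e" using g h by (intro L2_on_diff)
    have "integral\<^sup>L ?M (\<lambda>x. g n x * u x) - integral\<^sup>L ?M (\<lambda>x. h x * u x) = integral\<^sup>L ?M (\<lambda>x. ?e x * u x)"
      using L2_on_integrable_mult[OF g u] L2_on_integrable_mult[OF h u]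
      by (simp add: algebra_simps)
    also have "cmod \<dots> \<le> integral\<^sup>L ?M (\<lambda>x. cmod (?e x * u x))"
      by (rule integral_norm_bound)
    also have "\<dots> \<le> integral\<^sup>L ?M (\<lambda>x. d * (cmod (u x))\<^sup>2 + (cmod (?e x))\<^sup>2 / d)"
    proof (rule integral_mono)
      show "integrable ?M (\<lambda>x. cmod (?e x * u x))"
        using L2_on_integrable_mult[OF e u] by (rule integrable_norm)
      show "integrable ?M (\<lambda>x. d * (cmod (u x))\<^sup>2 + (cmod (?e x))\<^sup>2 / d)"
        using L2_on_integrable[OF e] L2_on_integrable[OF u] by simp
      show "cmod (?e x * u x) \<le> d * (cmod (u x))\<^sup>2 + (cmod (?e x))\<^sup>2 / d" for x
      proof -
        define a where "a = cmod (?e x)"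
        define b where "b = cmod (u x)"
        have "a * (d * b) \<le> a\<^sup>2 + (d * b)\<^sup>2"
          using sum_squares_bound[of a "d * b"] mult_nonneg_nonneg[of a "d * b"] d
          unfolding mult.assoc by (smt (verit) a_def b_def norm_ge_zero mult_nonneg_nonneg)
        then have "a * b \<le> d * b\<^sup>2 + a\<^sup>2 / d" using d by (simp add: field_simps power2_eq_square)
        then show ?thesis by (simp add: a_def b_def norm_mult)
      qed
    qed
    also have "\<dots> = d * L2_sq E u + L2_sq E ?e / d"
      using L2_on_integrable[OF e] L2_on_integrable[OF u] by (simp add: L2_sq_def)
    finally show ?thesis .
  qed
  show ?thesis
  proof (rule LIMSEQ_I)
    fix e :: real assume e: "e > 0"
    define d where "d = e / (3 * (L2_sq E u + 1))"
    have d: "d > 0" "d * L2_sq E u < e / 2"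
      using e by (auto simp: d_def field_simps add_pos_nonneg add_nonneg_pos intro!: divide_pos_pos)
    obtain N where N: "\<And>n. n \<ge> N \<Longrightarrow> L2_sq E (\<lambda>x. g n x - h x) < d * e / 2"
      using LIMSEQ_D[OF lim, of "d * e / 2"] d e by auto
    have "norm (integral\<^sup>L ?M (\<lambda>x. g n x * u x) - integral\<^sup>L ?M (\<lambda>x. h x * u x)) < e" if "n \<ge> N" for n
    proof -
      have "L2_sq E (\<lambda>x. g n x - h x) / d < e / 2"
        using N[OF that] d by (simp add: field_simps)
      then show ?thesis using key[OF d(1), of n] d(2) by linarith
    qed
    then show "\<exists>N. \<forall>n\<ge>N. norm (integral\<^sup>L ?M (\<lambda>x. g n x * u x) - integral\<^sup>L ?M (\<lambda>x. h x * u x)) < e"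
      by blast
  qed
qed

text \<open>Elements of almost minimal norm in the \<open>C n\<close> form a Cauchy sequence, by the parallelogram
  law; this replaces weak compactness.\<close>

lemma decreasing_convex_limit_point:
  fixes C :: "nat \<Rightarrow> (real \<Rightarrow> complex) set"
  assumes E: "E \<in> lmeasurable" and L2: "\<And>n g. g \<in> C n \<Longrightarrow> L2_on E g"
    and dec: "\<And>n. C (Suc n) \<subseteq> C n"
    and mid: "\<And>n g h. g \<in> C n \<Longrightarrow> h \<in> C n \<Longrightarrow> (\<lambda>x. (g x + h x) / 2) \<in> C n"
    and bdd: "\<And>n. \<exists>g \<in> C n. L2_sq E g \<le> B"
  obtains h g where "L2_on E h" "\<And>n. g n \<in> C n"
    "AE x in lebesgue_on E. (\<lambda>n. g n x) \<longlonglongrightarrow> h x"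
    "(\<lambda>n. L2_sq E (\<lambda>x. g n x - h x)) \<longlonglongrightarrow> 0"
proof -
  \<comment> \<open>The infima increase because the sets shrink, and B bounds them. Their
    convergence is what forces the near-minimal elements together.\<close>
  define r where "r n = Inf (L2_sq E ` C n)" for n
  have bb: "bdd_below (L2_sq E ` C n)" for n by (rule bdd_belowI[of _ 0]) auto
  have C_ne: "C n \<noteq> {}" for n using bdd by blast
  have dec': "C n \<subseteq> C m" if "m \<le> n" for m n
    using lift_Suc_antimono_le[of C, OF dec that] .
  have r_le: "r n \<le> L2_sq E g" if "g \<in> C n" for n g
    unfolding r_def using that by (intro cInf_lower bb) auto
  have inc: "incseq r"
  proof (rule incseq_SucI)
    show "r n \<le> r (Suc n)" for n
      unfolding r_def using C_ne dec by (intro cInf_superset_mono bb) auto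
  qed
  moreover have "r n \<le> B" for n using bdd[of n] r_le by (meson order_trans)
  ultimately have "convergent r" using Bseq_mono_convergent incseq_convergent
    by (metis convergentI)
  then have cr: "Cauchy r" by (rule convergent_Cauchy)
  have "\<exists>g\<in>C n. L2_sq E g < r n + 1 / Suc n" for n
    using cInf_lessD[of "L2_sq E ` C n" "r n + 1 / Suc n"] C_ne by (auto simp: r_def)
  then obtain g where g: "\<And>n. g n \<in> C n" and gr: "\<And>n. L2_sq E (g n) < r n + 1 / Suc n"
    by metis
  \<comment> \<open>Both elements lie in the larger set \<open>C m\<close>, hence so does their
    midpoint, whose squared norm is therefore at least \<open>r m\<close>. The parallelogram law
    leaves only the gap between the infima and the two tolerances for the difference.\<close>
  have est: "L2_sq E (\<lambda>x. g m x - g n x) \<le> 2 * (r n - r m) + 4 / Suc m" if "m \<le> n" for m n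
  proof -
    have "g n \<in> C m" using g[of n] dec'[OF that] by blast
    from r_le[OF mid[OF g[of m] this]]
    have "L2_sq E (\<lambda>x. g m x - g n x) \<le> 2 * (r m + 1 / Suc m) + 2 * (r n + 1 / Suc n) - 4 * r m"
      using L2_sq_parallelogram[OF L2[OF g[of m]] L2[OF g[of n]]] gr[of m] gr[of n] by argo
    moreover have "1 / real (Suc n) \<le> 1 / Suc m" using that by (simp add: frac_le)
    ultimately show ?thesis by argo
  qed
  have "\<exists>N. \<forall>m\<ge>N. \<forall>n\<ge>N. L2_sq E (\<lambda>x. g m x - g n x) \<le> e" if e: "e > 0" for e
  proof -
    obtain N1 where N1: "\<And>m n. m \<ge> N1 \<Longrightarrow> n \<ge> N1 \<Longrightarrow> \<bar>r m - r n\<bar> < e / 4"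
      using CauchyD[OF cr, of "e/4"] e by auto
    obtain N2 where N2: "1 / real (Suc N2) < e / 8" using e nat_approx_posE[of "e/8"] by auto
    define N where "N = max N1 N2"
    have *: "L2_sq E (\<lambda>x. g m x - g n x) \<le> e" if "N \<le> m" "m \<le> n" for m n
    proof -
      have "1 / real (Suc m) \<le> 1 / Suc N2" using that by (simp add: frac_le N_def)
      moreover have "\<bar>r n - r m\<bar> < e / 4" using that by (intro N1) (auto simp: N_def)
      ultimately show ?thesis using est[OF that(2)] N2 by argo
    qed
    have "L2_sq E (\<lambda>x. g m x - g n x) \<le> e" if "N \<le> m" "N \<le> n" for m n
    proof (cases "m \<le> n")
      case True then show ?thesis using * that by simp
    next
      case False
      then have "L2_sq E (\<lambda>x. g n x - g m x) \<le> e" using * that by simp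
      then show ?thesis by (simp add: L2_sq_def norm_minus_commute)
    qed
    then show ?thesis by blast
  qed
  from L2_complete[OF E L2[OF g] this]
  obtain h s where s: "L2_on E h" "strict_mono s"
    "AE x in lebesgue_on E. (\<lambda>n. g (s n) x) \<longlonglongrightarrow> h x"
    "(\<lambda>n. L2_sq E (\<lambda>x. g (s n) x - h x)) \<longlonglongrightarrow> 0" by blast
  \<comment> \<open>A subsequence only moves deeper into the decreasing sets. The limit h is not
    claimed to lie in them: no closedness is assumed, and each application proves the limit
    properties it wants.\<close>
  have "g (s n) \<in> C n" for n using g[of "s n"] dec'[OF seq_suble[OF s(2)]] by blast
  then show ?thesis using that[of h "\<lambda>n. g (s n)"] s by blast
qed

section \<open>Fourier coefficients of integrable functions\<close>

lemma circ_lmeasurable [simp]: "circ \<in> lmeasurable"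
  unfolding circ_def by (rule bounded_set_imp_lmeasurable) auto

lemma circ_sets [simp]: "circ \<in> sets lebesgue"
  by (simp add: fmeasurableD)

text \<open>Note the sign: \<open>fourier h n\<close> is \<open>2\<pi>\<close> times the coefficient of index \<open>-n\<close>.\<close>

definition fourier :: "(real \<Rightarrow> complex) \<Rightarrow> int \<Rightarrow> complex" where
  "fourier h n = integral\<^sup>L (lebesgue_on circ) (\<lambda>t. h t * cis (of_int n * t))"

text \<open>Integer indices make it possible to multiply by negative powers of e^{it} as well and to
  read the effect as a shift.\<close>

lemma H2_iff: "H2 g \<longleftrightarrow> L2_on circ g \<and> (\<forall>n\<ge>1. fourier g n = 0)"
proof -
  have "exp (\<i> * of_nat n * of_real t) = cis (of_int (int n) * t)" for n t
    by (simp add: cis_conv_exp algebra_simps)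
  then have *: "(LINT t|lebesgue_on circ. g t * exp (\<i> * of_nat n * of_real t)) = fourier g (int n)" for n
    by (simp add: fourier_def)
  have "(\<forall>n::nat. n \<ge> 1 \<longrightarrow> fourier g (int n) = 0) \<longleftrightarrow> (\<forall>n\<ge>1. fourier g n = 0)"
    by (metis int_one_le_iff_zero_less less_one linorder_not_le of_nat_0_less_iff zero_le_imp_eq_int
        order_trans zero_le_one)
  then show ?thesis unfolding H2_def * by blast
qed

lemma measurable_cis [measurable]: "(\<lambda>t. cis (c * t)) \<in> borel_measurable (lebesgue_on E)"
proof -
  have "continuous_on UNIV (\<lambda>t. cis (c * t))" by (intro continuous_intros)
  then have "(\<lambda>t. cis (c * t)) \<in> borel_measurable lborel"
    by (simp add: borel_measurable_continuous_onI)
  then show ?thesis by (intro measurable_restrict_space1 measurable_completion)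
qed

lemma L2_on_cis_mult: "L2_on E h \<Longrightarrow> L2_on E (\<lambda>t. cis (c * t) * h t)"
  by (rule L2_on_mult[where B = 1]) auto

lemma integrable_mult_bounded:
  fixes h b :: "'a \<Rightarrow> complex"
  assumes "integrable M h" "b \<in> borel_measurable M" "\<And>x. x \<in> space M \<Longrightarrow> cmod (b x) \<le> B"
  shows "integrable M (\<lambda>x. b x * h x)"
proof (rule Bochner_Integration.integrable_bound)
  show "integrable M (\<lambda>x. B * cmod (h x))" using assms(1) by simp
  show "(\<lambda>x. b x * h x) \<in> borel_measurable M" using assms by measurable
  have "cmod (b x) * cmod (h x) \<le> \<bar>B\<bar> * cmod (h x)" if "x \<in> space M" for x
    using assms(3)[OF that] by (intro mult_right_mono) auto
  then show "AE x in M. norm (b x * h x) \<le> norm (B * cmod (h x))"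
    by (auto simp: norm_mult abs_mult)
qed

lemma integrable_cis_mult:
  "integrable (lebesgue_on E) h \<Longrightarrow> integrable (lebesgue_on E) (\<lambda>t. cis (c * t) * h t)"
  by (rule integrable_mult_bounded[where B = 1]) auto

lemma fourier_shift: "fourier (\<lambda>t. cis (of_int k * t) * h t) n = fourier h (n + k)"
  unfolding fourier_def
  by (rule arg_cong[of _ _ "integral\<^sup>L _"]) (auto simp: fun_eq_iff cis_mult algebra_simps)

lemma fourier_add:
  assumes "integrable (lebesgue_on circ) g" "integrable (lebesgue_on circ) h"
  shows "fourier (\<lambda>t. g t + h t) n = fourier g n + fourier h n"
  using assms[THEN integrable_cis_mult, of "of_int n"]
  by (simp add: fourier_def ring_distribs mult.commute[of _ "cis _"])

lemma fourier_cmult: "fourier (\<lambda>t. c * h t) n = c * fourier h n"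
  by (simp add: fourier_def mult.assoc)

section \<open>Uniqueness of Fourier coefficients\<close>

definition all_fourier_zero :: "(real \<Rightarrow> complex) \<Rightarrow> bool" where
  "all_fourier_zero h \<longleftrightarrow> integrable (lebesgue_on circ) h \<and> (\<forall>n. fourier h n = 0)"

text \<open>On the circle a real linear functional is a combination of e^{it} and e^{-it}, so
  multiplying by it only shifts and combines coefficients. The function h is generalized because the
  product case applies one induction hypothesis to h and the other to the result; integrability
  travels inside \<open>all_fourier_zero\<close> for the same reason.\<close>

lemma all_fourier_zero_polynomial_mult:
  assumes "real_polynomial_function (p :: complex \<Rightarrow> real)" "all_fourier_zero h"
  shows "all_fourier_zero (\<lambda>t. of_real (p (cis t)) * h t)"
  using assms
proof (induction arbitrary: h rule: real_polynomial_function.induct)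
  case (linear f)
  interpret f: bounded_linear f by fact
  \<comment> \<open>Euler's formulas applied to f(e^{it}) = f(1) cos t + f(i) sin t.\<close>
  define a where "a = (complex_of_real (f 1) - \<i> * complex_of_real (f \<i>)) / 2"
  define b where "b = (complex_of_real (f 1) + \<i> * complex_of_real (f \<i>)) / 2"
  have f: "complex_of_real (f (cis t)) = a * cis (of_int 1 * t) + b * cis (of_int (-1) * t)" for t
  proof -
    have "cis t = cos t *\<^sub>R 1 + sin t *\<^sub>R \<i>" by (simp add: complex_eq_iff)
    then have "f (cis t) = cos t * f 1 + sin t * f \<i>" by (simp add: f.add f.scale)
    then show ?thesis by (simp add: a_def b_def complex_eq_iff field_simps)
  qed
  have eq: "(\<lambda>t. complex_of_real (f (cis t)) * h t)
      = (\<lambda>t. a * (cis (of_int 1 * t) * h t) + b * (cis (of_int (-1) * t) * h t))"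
    unfolding f by (simp add: algebra_simps)
  have i: "integrable (lebesgue_on circ) (\<lambda>t. c * (cis (d * t) * h t))" for c d
    using linear.prems by (simp add: all_fourier_zero_def integrable_cis_mult)
  show ?case unfolding eq all_fourier_zero_def
  proof (intro conjI allI)
    show "fourier (\<lambda>t. a * (cis (of_int 1 * t) * h t) + b * (cis (of_int (-1) * t) * h t)) n = 0" for n
      using linear.prems by (simp add: fourier_add[OF i i] fourier_cmult fourier_shift all_fourier_zero_def
        del: of_int_1 of_int_minus)
  qed (intro Bochner_Integration.integrable_add i)
next
  case (const c)
  then show ?case by (auto simp: all_fourier_zero_def fourier_cmult)
next
  case (add f g)
  have "(\<lambda>t. complex_of_real (f (cis t) + g (cis t)) * h t)
      = (\<lambda>t. complex_of_real (f (cis t)) * h t + complex_of_real (g (cis t)) * h t)"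
    by (simp add: algebra_simps)
  then show ?case using add.IH[OF add.prems] by (simp add: all_fourier_zero_def fourier_add)
next
  case (mult f g)
  have "(\<lambda>t. complex_of_real (f (cis t) * g (cis t)) * h t)
      = (\<lambda>t. complex_of_real (f (cis t)) * (complex_of_real (g (cis t)) * h t))"
    by (simp add: algebra_simps)
  then show ?case using mult.IH mult.prems by simp
qed

text \<open>Stone-Weierstrass on the compact circle: replacing g by a polynomial within e costs at
  most e times the L1 norm of h. Taking g as a function on the circle builds in periodicity.\<close>

lemma all_fourier_zero_imp_integral_continuous:
  fixes g :: "complex \<Rightarrow> real"
  assumes h: "all_fourier_zero h" and g: "continuous_on (sphere 0 1) g"
  shows "integrable (lebesgue_on circ) (\<lambda>t. of_real (g (cis t)) * h t)"
    and "integral\<^sup>L (lebesgue_on circ) (\<lambda>t. of_real (g (cis t)) * h t) = 0"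
proof -
  let ?M = "lebesgue_on circ"
  have hi: "integrable ?M h" using h by (simp add: all_fourier_zero_def)
  have "continuous_on UNIV (\<lambda>t. complex_of_real (g (cis t)))"
    by (intro continuous_on_of_real continuous_on_compose2[OF g]) (auto intro!: continuous_intros)
  then have "(\<lambda>t. complex_of_real (g (cis t))) \<in> borel_measurable lborel"
    by (simp add: borel_measurable_continuous_onI)
  then have gm: "(\<lambda>t. complex_of_real (g (cis t))) \<in> borel_measurable ?M"
    by (intro measurable_restrict_space1 measurable_completion)
  have "compact (g ` sphere 0 1)" using g by (intro compact_continuous_image) auto
  then obtain B where B: "\<And>z. z \<in> sphere 0 1 \<Longrightarrow> \<bar>g z\<bar> \<le> B"
    using compact_imp_bounded by (fastforce simp: bounded_iff)
  show gi: "integrable ?M (\<lambda>t. of_real (g (cis t)) * h t)"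
    using B by (intro integrable_mult_bounded[OF hi gm, of B]) auto
  define H where "H = integral\<^sup>L ?M (\<lambda>t. cmod (h t))"
  have H: "H \<ge> 0" by (simp add: H_def)
  have bound: "cmod (integral\<^sup>L ?M (\<lambda>t. of_real (g (cis t)) * h t)) \<le> e * H" if e: "e > 0" for e
  proof -
    obtain p where p: "real_polynomial_function p" "\<And>z. z \<in> sphere 0 1 \<Longrightarrow> \<bar>g z - p z\<bar> < e"
      using Stone_Weierstrass_real_polynomial_function[OF _ g e] by auto
    have ph: "all_fourier_zero (\<lambda>t. of_real (p (cis t)) * h t)"
      by (rule all_fourier_zero_polynomial_mult[OF p(1) h])
    then have "fourier (\<lambda>t. of_real (p (cis t)) * h t) 0 = 0"
      and pi: "integrable ?M (\<lambda>t. of_real (p (cis t)) * h t)"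
      unfolding all_fourier_zero_def by auto
    then have "integral\<^sup>L ?M (\<lambda>t. of_real (g (cis t)) * h t)
        = integral\<^sup>L ?M (\<lambda>t. of_real (g (cis t)) * h t - of_real (p (cis t)) * h t)"
      using gi by (simp add: fourier_def)
    also have "cmod \<dots> \<le> integral\<^sup>L ?M (\<lambda>t. cmod (of_real (g (cis t)) * h t - of_real (p (cis t)) * h t))"
      by (rule integral_norm_bound)
    also have "\<dots> \<le> integral\<^sup>L ?M (\<lambda>t. e * cmod (h t))"
    proof (rule integral_mono)
      show "cmod (of_real (g (cis t)) * h t - of_real (p (cis t)) * h t) \<le> e * cmod (h t)" for t
      proof -
        have "of_real (g (cis t)) * h t - of_real (p (cis t)) * h t = of_real (g (cis t) - p (cis t)) * h t"
          by (simp add: algebra_simps)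
        moreover have "\<bar>g (cis t) - p (cis t)\<bar> \<le> e" using p(2)[of "cis t"] by simp
        ultimately show ?thesis by (simp only: norm_mult norm_of_real) (intro mult_right_mono, auto)
      qed
    qed (use gi pi hi in auto)
    also have "\<dots> = e * H" by (simp add: H_def)
    finally show ?thesis .
  qed
  have "cmod (integral\<^sup>L ?M (\<lambda>t. of_real (g (cis t)) * h t)) \<le> 0"
  proof (rule field_le_epsilon)
    fix e :: real assume "e > 0"
    then have "e / (H + 1) * H \<le> e" and "e / (H + 1) > 0" using H by (auto simp: field_simps)
    then show "cmod (integral\<^sup>L ?M (\<lambda>t. of_real (g (cis t)) * h t)) \<le> 0 + e"
      using bound[of "e / (H + 1)"] by linarith
  qed
  then show "integral\<^sup>L ?M (\<lambda>t. of_real (g (cis t)) * h t) = 0" by simp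
qed

text \<open>This carries compact sets of angles to the circle and back. The half-open interval
  matters, since 0 and 2 pi give the same point.\<close>

lemma cis_inj_on_circ: "inj_on cis circ"
proof (rule inj_onI)
  fix x y assume "x \<in> circ" "y \<in> circ" "cis x = cis y"
  then have "cis (x - y) = 1" by (simp flip: cis_divide)
  then have "cos (x - y) = 1" by (metis cis.sel(1) one_complex.sel(1))
  then obtain n :: int where n: "x - y = of_int n * 2 * pi" by (auto simp: cos_one_2pi_int)
  have "\<bar>x - y\<bar> < 2 * pi" using \<open>x \<in> circ\<close> \<open>y \<in> circ\<close> by (auto simp: circ_def)
  then have "\<bar>of_int n\<bar> * (2 * pi) < 1 * (2 * pi)" unfolding n by (simp add: abs_mult)
  then have "\<bar>real_of_int n\<bar> < 1" by (subst (asm) mult_less_cancel_right_pos) auto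
  then have "n = 0" by linarith
  then show "x = y" using n by simp
qed

text \<open>The indicator of the closed image of T on the circle is a pointwise limit of continuous
  functions with values in [0,1], so dominated convergence with majorant |h| applies.\<close>

lemma all_fourier_zero_imp_integral_compact:
  assumes h: "all_fourier_zero h" and T: "compact T" "T \<subseteq> circ"
  shows "integral\<^sup>L (lebesgue_on circ) (\<lambda>t. indicator T t * h t) = 0"
proof (cases "T = {}")
  \<comment> \<open>\<open>infdist\<close> to the empty set is 0 by convention, which would make
    every \<open>g k\<close> below constantly 1; hence the separate case.\<close>
  case False
  let ?M = "lebesgue_on circ"
  have hi: "integrable ?M h" using h by (simp add: all_fourier_zero_def)
  define A where "A = cis ` T"
  have "compact A" unfolding A_def using T by (intro compact_continuous_image continuous_intros)
  then have A: "closed A" "A \<noteq> {}" using False by (auto simp: A_def compact_imp_closed)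
  have A_iff: "cis t \<in> A \<longleftrightarrow> t \<in> T" if "t \<in> circ" for t
    using that T(2) cis_inj_on_circ by (auto simp: A_def inj_on_def)
  \<comment> \<open>These functions are 1 on A and, for k \<ge> 1, vanish at distance at least 1/k
    from A. They tend to the indicator of A because A is closed.\<close>
  define g where "g k z = max 0 (1 - real k * infdist z A)" for k z
  have g: "continuous_on (sphere 0 1) (g k)" for k
    unfolding g_def by (intro continuous_intros)
  have lim: "(\<lambda>k. g k z) \<longlonglongrightarrow> indicator A z" for z
  proof (cases "z \<in> A")
    case True
    then show ?thesis by (simp add: g_def)
  next
    case False
    then have d: "infdist z A > 0"
      using A infdist_nonneg[of z A] by (metis in_closed_iff_infdist_zero order_le_less)
    obtain N where N: "real N > 1 / infdist z A" using reals_Archimedean2 by blast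
    have "g k z = 0" if "k \<ge> N" for k
    proof -
      have "1 / infdist z A < real k" using N that by (meson less_le_trans of_nat_le_iff)
      then show ?thesis using d by (simp add: g_def field_simps)
    qed
    then show ?thesis using False by (auto intro!: tendsto_eventually eventually_sequentiallyI[of N])
  qed
  have "(\<lambda>k. integral\<^sup>L ?M (\<lambda>t. of_real (g k (cis t)) * h t)) \<longlonglongrightarrow> integral\<^sup>L ?M (\<lambda>t. indicator T t * h t)"
  proof (rule integral_dominated_convergence[where w = "\<lambda>t. cmod (h t)"])
    show "(\<lambda>t. of_real (g k (cis t)) * h t) \<in> borel_measurable ?M" for k
      using all_fourier_zero_imp_integral_continuous(1)[OF h g] by simp
    have "T \<in> sets lborel" using T by (simp add: borel_compact)
    then have "indicator T \<in> borel_measurable ?M"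
      by (intro measurable_restrict_space1 measurable_completion) simp
    then show "(\<lambda>t. indicator T t * h t) \<in> borel_measurable ?M"
      using hi by measurable
    show "AE t in ?M. (\<lambda>k. of_real (g k (cis t)) * h t) \<longlonglongrightarrow> indicator T t * h t"
    proof (rule AE_I2)
      fix t assume "t \<in> space ?M"
      then have "complex_of_real (indicator A (cis t)) = indicator T t"
        using A_iff[of t] by (simp add: indicator_def)
      then show "(\<lambda>k. of_real (g k (cis t)) * h t) \<longlonglongrightarrow> indicator T t * h t"
        using tendsto_mult[OF tendsto_of_real[OF lim[of "cis t"]] tendsto_const[of "h t"]] by simp
    qed
    have "g k z \<le> 1" "0 \<le> g k z" for k z by (auto simp: g_def infdist_nonneg)
    then show "AE t in ?M. norm (of_real (g k (cis t)) * h t) \<le> cmod (h t)" for k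
      by (auto simp: norm_mult intro!: mult_left_le_one_le)
  qed (use hi in simp)
  then show ?thesis
    by (simp add: all_fourier_zero_imp_integral_continuous(2)[OF h g] LIMSEQ_const_iff)
qed simp

text \<open>Inner regularity: if u were positive on a set of positive measure, so it would be on a
  compact subset of positive measure, and the integral over that subset could not be zero. The
  one-sided form suits real parts of rotated complex functions.\<close>

lemma AE_nonpos_if_integral_compact_zero:
  fixes u :: "real \<Rightarrow> real"
  assumes u: "integrable (lebesgue_on S) u" and S: "S \<in> lmeasurable" "bounded S"
    and zero: "\<And>T. compact T \<Longrightarrow> T \<subseteq> S \<Longrightarrow> integral\<^sup>L (lebesgue_on S) (\<lambda>t. indicator T t * u t) = 0"
  shows "AE t in lebesgue_on S. u t \<le> 0"
proof -
  let ?M = "lebesgue_on S"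
  define P where "P = {t \<in> S. u t > 0}"
  have Sl: "S \<in> sets lebesgue" using S by (simp add: fmeasurableD)
  have "{t \<in> space ?M. u t > 0} \<in> sets ?M" using u by measurable
  then have P: "P \<in> sets lebesgue"
    using Sl by (simp add: P_def sets_restrict_space_iff)
  have fin: "emeasure lebesgue P < \<infinity>"
    using emeasure_mono[of P S lebesgue] S Sl by (auto simp: P_def fmeasurable_def intro: le_less_trans)
  have "emeasure lebesgue P = 0"
  proof (rule ccontr)
    assume "emeasure lebesgue P \<noteq> 0"
    then have pos: "measure lebesgue P > 0"
      using fin by (simp add: measure_def enn2real_positive_iff zero_less_iff_neq_zero)
    have Pe: "emeasure lebesgue P = ennreal (measure lebesgue P)"
      using fin by (simp add: emeasure_eq_ennreal_measure)
    \<comment> \<open>With the measure of P itself as tolerance, T is forced to have positive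
      measure.\<close>
    obtain T where T: "closed T" "T \<subseteq> P" "emeasure lebesgue (P - T) < ennreal (measure lebesgue P)"
      using sets_lebesgue_inner_closed[OF P pos] by metis
    have TS: "T \<subseteq> S" using T(2) by (auto simp: P_def)
    have cT: "compact T" using T(1) TS S(2) by (meson bounded_subset compact_eq_bounded_closed)
    then have Tl: "T \<in> sets lebesgue" by (simp add: borel_compact)
    have Ti: "integrable ?M (\<lambda>t. indicator T t * u t)"
      using integrable_mult_indicator[of T ?M u] u Tl TS Sl
      by (simp add: sets_restrict_space_iff)
    have nn: "0 \<le> indicator T t * u t" for t
      using T(2) by (auto simp: P_def indicator_def intro: less_imp_le)
    have "AE t in ?M. indicator T t * u t = 0"
      using integral_nonneg_eq_0_iff_AE[OF Ti] nn zero[OF cT TS] by simp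
    then have "AE t in ?M. t \<notin> T"
    proof eventually_elim
      case (elim t)
      then show ?case using T(2) by (auto simp: P_def)
    qed
    then have "AE t in lebesgue. t \<notin> T"
      using TS Sl by (subst (asm) AE_restrict_space_iff) (auto elim!: eventually_mono)
    then have "emeasure lebesgue T = 0" using Tl by (simp add: AE_iff_null_sets null_setsD1)
    then have "emeasure lebesgue P \<le> emeasure lebesgue (P - T)"
      using emeasure_subadditive[of "P - T" lebesgue T] P Tl T(2) by (simp add: Un_absorb2)
    then show False using T(3) Pe by simp
  qed
  then have "P \<in> null_sets lebesgue" using P by auto
  then have "AE t in lebesgue. t \<notin> P" by (rule AE_not_in)
  then have "AE t in lebesgue. t \<in> S \<longrightarrow> u t \<le> 0"
    by eventually_elim (auto simp: P_def)
  then show ?thesis using Sl by (subst AE_restrict_space_iff) auto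
qed

text \<open>Integrability is the right generality: besides elements of H2, the theorem is applied to
  the squared modulus of an L2 function.\<close>

theorem fourier_uniqueness:
  assumes "integrable (lebesgue_on circ) h" and "\<And>n. fourier h n = 0"
  shows "AE t in lebesgue_on circ. h t = 0"
proof -
  let ?M = "lebesgue_on circ"
  have h: "all_fourier_zero h" using assms by (simp add: all_fourier_zero_def)
  have b: "bounded circ" by (simp add: circ_def)
  have *: "AE t in ?M. Re (c * h t) \<le> 0" for c
  proof (rule AE_nonpos_if_integral_compact_zero[OF _ circ_lmeasurable b])
    show "integrable ?M (\<lambda>t. Re (c * h t))" using assms(1) by (intro integrable_Re) simp
    fix T assume T: "compact T" "T \<subseteq> circ"
    then have Tl: "T \<in> sets lebesgue" by (simp add: borel_compact)
    have "integrable ?M (\<lambda>t. indicator T t *\<^sub>R h t)"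
      using T Tl by (intro integrable_mult_indicator assms(1)) (simp add: sets_restrict_space_iff)
    then have i: "integrable ?M (\<lambda>t. c * (indicator T t * h t))"
      by (simp add: scaleR_conv_of_real of_real_indicator)
    have "indicator T t * Re (c * h t) = Re (c * (indicator T t * h t))" for t
      by (simp add: indicator_def)
    then have "(LINT t|?M. indicator T t * Re (c * h t)) = Re (LINT t|?M. c * (indicator T t * h t))"
      by (simp only: integral_Re[OF i])
    also have "\<dots> = Re (c * (LINT t|?M. indicator T t * h t))" by simp
    also have "\<dots> = 0" using all_fourier_zero_imp_integral_compact[OF h T] by simp
    finally show "(LINT t|?M. indicator T t * Re (c * h t)) = 0" .
  qed
  \<comment> \<open>The four directions bound the real and imaginary parts of h from both
    sides.\<close>
  show ?thesis using *[of 1] *[of "-1"] *[of \<i>] *[of "-\<i>"]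
    by eventually_elim (simp add: complex_eq_iff)
qed

section \<open>Uniqueness in the Hardy space\<close>

text \<open>First variation: moving against the inner product z, by c = -e z, changes the squared
  norm by -2 e |z|^2 + e^2 |z|^2 s, which is negative for small e > 0. Minimality is asked only for
  |c| \<le> d because a constraint may admit only small perturbations.\<close>

lemma L2_sq_min_orthogonal:
  assumes g: "L2_on E g" and h: "L2_on E h" and d: "d > 0"
    and min: "\<And>c. cmod c \<le> d \<Longrightarrow> L2_sq E g \<le> L2_sq E (\<lambda>x. g x + c * h x)"
  shows "integral\<^sup>L (lebesgue_on E) (\<lambda>x. g x * cnj (h x)) = 0"
proof (rule ccontr)
  define z where "z = integral\<^sup>L (lebesgue_on E) (\<lambda>x. g x * cnj (h x))"
  define s where "s = L2_sq E h"
  \<comment> \<open>The first bound gives e s < 1, so the linear term wins; the second keeps |c|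
    within d.\<close>
  define e where "e = min (1 / (s + 1)) (d / cmod z)"
  assume "integral\<^sup>L (lebesgue_on E) (\<lambda>x. g x * cnj (h x)) \<noteq> 0"
  then have z: "cmod z > 0" by (simp add: z_def)
  have s: "s \<ge> 0" by (simp add: s_def)
  have e: "e > 0" using s z d by (simp add: e_def add_nonneg_pos)
  have "e * cmod z \<le> d" using z by (simp add: e_def min_def field_simps)
  then have c: "cmod (- of_real e * z) \<le> d" using e by (simp add: norm_mult)
  have "e * s \<le> 1 / (s + 1) * s" using s by (intro mult_right_mono) (auto simp: e_def)
  also have "\<dots> < 1" using s by simp
  finally have es: "e * s < 1" .
  have "g x * cnj ((- of_real e * z) * h x) = (- of_real e * cnj z) * (g x * cnj (h x))" for x
    by simp
  then have "integral\<^sup>L (lebesgue_on E) (\<lambda>x. g x * cnj ((- of_real e * z) * h x)) = - of_real e * cnj z * z"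
    by (simp only: z_def integral_mult_right_zero)
  also have "\<dots> = of_real (- e * (cmod z)\<^sup>2)"
    by (simp add: mult.commute[of "cnj z"] complex_norm_square mult.assoc del: of_real_power)
  finally have "0 \<le> 2 * (- e * (cmod z)\<^sup>2) + (e * cmod z)\<^sup>2 * s"
    using min[OF c] L2_sq_add[OF g L2_on_cmult[OF h, of "- of_real e * z"]]
    by (simp only: L2_sq_cmult s_def norm_mult norm_minus_cancel norm_of_real Re_complex_of_real abs_of_pos[OF e])
  also have "\<dots> = e * (cmod z)\<^sup>2 * (e * s - 2)" by (simp add: power2_eq_square algebra_simps)
  also have "\<dots> < 0" using e z es by (intro mult_pos_neg) auto
  finally show False by simp
qed

lemma fourier_one: "fourier (\<lambda>t. 1) n = (if n = 0 then 2 * pi else 0)"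
proof -
  have int: "((\<lambda>t. cis (of_int n * t)) has_integral (if n = 0 then 2 * pi else 0)) {0..2*pi}"
  proof (cases "n = 0")
    case True
    have "((\<lambda>t. 1::complex) has_integral (2*pi) *\<^sub>R 1) {0..2*pi}"
      using has_integral_const_real[of "1::complex" 0 "2*pi"] by simp
    moreover have "(2*pi) *\<^sub>R (1::complex) = (if n = 0 then 2 * pi else 0)"
      using True by (simp only: scaleR_conv_of_real if_True mult_1_right refl)
    ultimately show ?thesis using True by (simp only: of_int_0 mult_zero_left cis_zero)
  next
    case False
    define F where "F t = cis (of_int n * t) / (\<i> * of_int n)" for t
    have "((\<lambda>t. cis (of_int n * t)) has_integral (F (2*pi) - F 0)) {0..2*pi}"
    proof (rule fundamental_theorem_of_calculus)
      fix t
      have "((\<lambda>z. exp (\<i> * of_int n * z) / (\<i> * of_int n)) has_field_derivative exp (\<i> * of_int n * of_real t))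
          (at (of_real t))"
        using False by (auto intro!: derivative_eq_intros)
      then have "((\<lambda>t. exp (\<i> * of_int n * of_real t) / (\<i> * of_int n)) has_vector_derivative
          exp (\<i> * of_int n * of_real t)) (at t within {0..2*pi})"
        by (rule has_vector_derivative_real_field)
      then show "(F has_vector_derivative cis (of_int n * t)) (at t within {0..2*pi})"
        by (simp add: F_def[abs_def] cis_conv_exp algebra_simps)
    qed simp
    moreover have "F (2*pi) = F 0"
      using cis_multiple_2pi[of "of_int n"] by (simp add: F_def mult_ac)
    ultimately show ?thesis using False by simp
  qed
  \<comment> \<open>The half-open and the closed interval differ only in the point 2 pi.\<close>
  have "circ - {0..2*pi} \<subseteq> {2*pi}" "{0..2*pi} - circ \<subseteq> {2*pi}" by (auto simp: circ_def)
  then have int': "((\<lambda>t. cis (of_int n * t)) has_integral (if n = 0 then 2 * pi else 0)) circ"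
    using int by (subst has_integral_spike_set_eq[of circ "{0..2*pi}"])
      (blast intro: negligible_subset[OF negligible_sing])+
  have "integrable (lebesgue_on circ) (\<lambda>t. cis (of_int n * t))"
    using integrable_cis_mult[OF L2_on_imp_integrable[OF _ L2_on_const, of circ 1]] by simp
  then show ?thesis
    using int' by (simp add: fourier_def lebesgue_integral_eq_integral integral_unique)
qed

section \<open>Closure properties of the Hardy space\<close>

lemma H2_imp_L2: "H2 h \<Longrightarrow> L2_on circ h"
  by (simp add: H2_def)

lemma H2_imp_integrable: "H2 h \<Longrightarrow> integrable (lebesgue_on circ) h"
  by (rule L2_on_imp_integrable) (auto simp: H2_def)

lemma H2_zero [simp]: "H2 (\<lambda>t. 0)"
  by (simp add: H2_def)

lemma H2_add: "H2 g \<Longrightarrow> H2 h \<Longrightarrow> H2 (\<lambda>t. g t + h t)"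
  using H2_imp_integrable by (auto simp: H2_iff L2_on_add fourier_add)

lemma H2_cmult: "H2 h \<Longrightarrow> H2 (\<lambda>t. c * h t)"
  by (auto simp: H2_iff L2_on_cmult fourier_cmult)

lemma H2_diff: "H2 g \<Longrightarrow> H2 h \<Longrightarrow> H2 (\<lambda>t. g t - h t)"
  using H2_add[OF _ H2_cmult[of h "-1"]] by simp

lemma H2_mid: "H2 g \<Longrightarrow> H2 h \<Longrightarrow> H2 (\<lambda>t. (g t + h t) / 2)"
  using H2_cmult[OF H2_add, of g h "1/2"] by simp

lemma H2_cis_mult:
  assumes "H2 h" "k \<ge> 0"
  shows "H2 (\<lambda>t. cis (of_int k * t) * h t)"
  using assms by (auto simp: H2_iff L2_on_cis_mult fourier_shift)

lemma fourier_tendsto: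
  assumes "\<And>n. L2_on circ (g n)" "L2_on circ h" "(\<lambda>n. L2_sq circ (\<lambda>x. g n x - h x)) \<longlonglongrightarrow> 0"
  shows "(\<lambda>n. fourier (g n) k) \<longlonglongrightarrow> fourier h k"
  unfolding fourier_def
  by (rule L2_tendsto_integral_mult[OF assms(1,2) _ assms(3)])
    (use L2_on_cis_mult[OF L2_on_const[of circ 1]] in simp)

lemma H2_limit:
  assumes "\<And>n. H2 (g n)" "L2_on circ h" "(\<lambda>n. L2_sq circ (\<lambda>x. g n x - h x)) \<longlonglongrightarrow> 0"
  shows "H2 h"
  unfolding H2_iff
proof (intro conjI allI impI)
  fix k :: int assume "k \<ge> 1"
  then have "fourier (g n) k = 0" for n using assms(1) by (simp add: H2_iff)
  then show "fourier h k = 0"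
    using fourier_tendsto[OF H2_imp_L2[OF assms(1)] assms(2,3), of k] by (simp add: LIMSEQ_const_iff)
qed (fact assms(2))

text \<open>Prescribing the mean turns the question into a least-norm problem: the condition is
  affine, so K is closed under midpoints and omits the zero function.\<close>

lemma H2_vanishing_mean:
  assumes E: "E \<in> sets lebesgue" "E \<subseteq> circ" "emeasure lebesgue E > 0"
    and h: "H2 h" "AE x in lebesgue_on circ. x \<in> E \<longrightarrow> h x = 0"
  shows "fourier h 0 \<noteq> 1"
proof
  assume h1: "fourier h 0 = 1"
  let ?M = "lebesgue_on circ"
  define K where "K = {\<phi>. H2 \<phi> \<and> fourier \<phi> 0 = 1 \<and> (AE x in ?M. x \<in> E \<longrightarrow> \<phi> x = 0)}"
  have hK: "h \<in> K" using h h1 by (simp add: K_def)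
  define m where "m = Inf (L2_sq circ ` K)"
  have m_le: "m \<le> L2_sq circ \<phi>" if "\<phi> \<in> K" for \<phi>
    unfolding m_def using that by (intro cInf_lower) (auto intro!: bdd_belowI[of _ 0])
  \<comment> \<open>The sets are sublevel sets of the norm itself, so the limit lemma produces a
    least-norm element of K.\<close>
  define C where "C n = {\<phi> \<in> K. L2_sq circ \<phi> \<le> m + 1 / Suc n}" for n
  obtain \<phi> g where \<phi>: "L2_on circ \<phi>" "\<And>n. g n \<in> C n" "AE x in ?M. (\<lambda>n. g n x) \<longlonglongrightarrow> \<phi> x"
    "(\<lambda>n. L2_sq circ (\<lambda>x. g n x - \<phi> x)) \<longlonglongrightarrow> 0"
  proof (rule decreasing_convex_limit_point[of circ C "m + 1"])
    show "L2_on circ g" if "g \<in> C n" for n g using that by (simp add: C_def K_def H2_imp_L2)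
    show "C (Suc n) \<subseteq> C n" for n
    proof -
      have "1 / real (Suc (Suc n)) \<le> 1 / Suc n" by (simp add: frac_le)
      then show ?thesis by (auto simp: C_def simp del: of_nat_Suc)
    qed
    show "(\<lambda>x. (g1 x + g2 x) / 2) \<in> C n" if g: "g1 \<in> C n" "g2 \<in> C n" for n g1 g2
    proof -
      have H: "H2 g1" "H2 g2" using g by (auto simp: C_def K_def)
      have "fourier (\<lambda>x. (g1 x + g2 x) / 2) 0 = 1"
        using fourier_cmult[of "1/2" "\<lambda>x. g1 x + g2 x" 0] fourier_add[OF H[THEN H2_imp_integrable]] g
        by (simp add: C_def K_def)
      moreover have "AE x in ?M. x \<in> E \<longrightarrow> g1 x = 0" "AE x in ?M. x \<in> E \<longrightarrow> g2 x = 0"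
        using g by (auto simp: C_def K_def)
      then have "AE x in ?M. x \<in> E \<longrightarrow> (g1 x + g2 x) / 2 = 0" by eventually_elim simp
      moreover have "L2_sq circ (\<lambda>x. (g1 x + g2 x) / 2) \<le> m + 1 / Suc n"
      proof -
        have "L2_sq circ g1 \<le> m + 1 / Suc n" "L2_sq circ g2 \<le> m + 1 / Suc n"
          using g by (auto simp: C_def)
        then show ?thesis
          using L2_sq_parallelogram[OF H[THEN H2_imp_L2]] L2_sq_nonneg[of circ "\<lambda>x. g1 x - g2 x"]
          by argo
      qed
      ultimately show ?thesis using H2_mid[OF H] by (simp add: C_def K_def)
    qed
    show "\<exists>g\<in>C n. L2_sq circ g \<le> m + 1" for n
    proof -
      have "\<exists>g\<in>K. L2_sq circ g < m + 1 / Suc n"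
        using cInf_lessD[of "L2_sq circ ` K" "m + 1 / Suc n"] hK by (auto simp: m_def)
      then obtain g where "g \<in> K" "L2_sq circ g < m + 1 / Suc n" by blast
      moreover from this have "L2_sq circ g \<le> m + 1"
        using le_divide_eq_1_pos[of "real (Suc n)" 1] by (smt (verit) divide_le_eq_1 of_nat_0_le_iff of_nat_Suc)
      ultimately show ?thesis by (intro bexI[of _ g]) (auto simp: C_def)
    qed
  qed (rule circ_lmeasurable, rule that)
  have gH: "H2 (g n)" and gf: "fourier (g n) 0 = 1" and gE: "AE x in ?M. x \<in> E \<longrightarrow> g n x = 0" for n
    using \<phi>(2)[of n] by (auto simp: C_def K_def)
  have H: "H2 \<phi>" by (rule H2_limit[OF gH \<phi>(1,4)])
  have f0: "fourier \<phi> 0 = 1"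
    using fourier_tendsto[OF H2_imp_L2[OF gH] \<phi>(1,4), of 0] by (simp add: gf LIMSEQ_const_iff)
  have "AE x in ?M. \<forall>n. x \<in> E \<longrightarrow> g n x = 0" unfolding AE_all_countable using gE by blast
  then have \<phi>E: "AE x in ?M. x \<in> E \<longrightarrow> \<phi> x = 0"
    using \<phi>(3) by eventually_elim (auto simp: LIMSEQ_const_iff)
  have "(\<lambda>n. m + 1 / real (Suc n)) \<longlonglongrightarrow> m + 0"
    by (intro tendsto_intros LIMSEQ_Suc lim_1_over_n)
  then have "L2_sq circ \<phi> \<le> m"
    using L2_fatou[OF H2_imp_L2[OF gH] L2_on_measurable[OF \<phi>(1)] \<phi>(3), of "\<lambda>n. m + 1 / Suc n" m]
      \<phi>(2) by (simp add: C_def)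
  then have min: "L2_sq circ \<phi> \<le> L2_sq circ \<psi>" if "\<psi> \<in> K" for \<psi> using m_le[OF that] by simp
  define w where "w t = complex_of_real ((cmod (\<phi> t))\<^sup>2)" for t
  have wi: "integrable ?M w"
    unfolding w_def using L2_on_integrable[OF \<phi>(1)] by (rule integrable_of_real)
  \<comment> \<open>The product of \<open>\<phi>\<close> with the conjugate of e^{int}
    \<open>\<phi>\<close> is |\<open>\<phi>\<close>|^2 e^{-int}, so orthogonality is a statement
    about one coefficient of w.\<close>
  have neg: "fourier w (- n) = 0" if n: "n \<ge> 1" for n
  proof -
    let ?h = "\<lambda>t. cis (of_int n * t) * \<phi> t"
    have "integral\<^sup>L ?M (\<lambda>t. \<phi> t * cnj (?h t)) = 0"
    proof (rule L2_sq_min_orthogonal[OF \<phi>(1) L2_on_cis_mult[OF \<phi>(1)] zero_less_one])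
      fix c :: complex
      have Hh: "H2 ?h" using n by (intro H2_cis_mult H) simp
      \<comment> \<open>The perturbation has mean zero: its coefficient at 0 is
        \<open>fourier \<phi> n\<close>, which vanishes for n \<ge> 1 since \<open>\<phi>\<close> is
        in H2.\<close>
      have "fourier (\<lambda>t. \<phi> t + c * ?h t) 0 = 1"
        using n H f0
        by (simp add: fourier_add H2_imp_integrable H2_cmult Hh fourier_cmult fourier_shift)
           (simp add: H2_iff)
      then have "(\<lambda>t. \<phi> t + c * ?h t) \<in> K"
        using H2_add[OF H H2_cmult[OF Hh]] \<phi>E by (auto simp: K_def elim!: eventually_mono)
      then show "L2_sq circ \<phi> \<le> L2_sq circ (\<lambda>t. \<phi> t + c * ?h t)" by (rule min)
    qed
    moreover have "\<phi> t * cnj (?h t) = w t * cis (of_int (- n) * t)" for t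
      by (simp add: w_def cis_cnj complex_norm_square mult_ac del: of_real_power)
    ultimately show ?thesis by (simp add: fourier_def)
  qed
  \<comment> \<open>w is real-valued, so opposite coefficients are conjugate and the other half of
    them vanishes too.\<close>
  have conj: "fourier w n = cnj (fourier w (- n))" for n
  proof -
    have "(\<lambda>t. w t * cis (of_int n * t)) = (\<lambda>t. cnj (w t * cis (of_int (- n) * t)))"
      by (simp add: w_def cis_cnj)
    then have "fourier w n = integral\<^sup>L ?M (\<lambda>t. cnj (w t * cis (of_int (- n) * t)))"
      unfolding fourier_def by (rule arg_cong)
    then show ?thesis unfolding fourier_def Bochner_Integration.integral_cnj .
  qed
  have pos: "fourier w n = 0" if "n \<ge> 1" for n
    by (simp only: conj[of n] neg[OF that] complex_cnj_zero)
  \<comment> \<open>This is the mean of w; subtracting it removes the only coefficient left.\<close>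
  define c where "c = fourier w 0 / (2 * pi)"
  have ci: "integrable ?M (\<lambda>t. - c)" using L2_on_imp_integrable[OF _ L2_on_const] by simp
  have "AE t in ?M. w t + - c = 0"
  proof (rule fourier_uniqueness)
    show "integrable ?M (\<lambda>t. w t + - c)" using wi ci by (rule Bochner_Integration.integrable_add)
    have "fourier (\<lambda>t. - c) n = - c * (if n = 0 then 2 * pi else 0)" for n
      using fourier_cmult[of "- c" "\<lambda>t. 1"] by (simp add: fourier_one)
    then show "fourier (\<lambda>t. w t + - c) n = 0" for n
      using pos[of n] neg[of "- n"] unfolding fourier_add[OF wi ci]
      by (cases n "0::int" rule: linorder_cases) (auto simp: c_def)
  qed
  then have wc: "AE t in ?M. w t = c" by simp
  \<comment> \<open>w vanishes almost everywhere on E, which has positive measure, so the constant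
    cannot be anything else.\<close>
  have "c = 0"
  proof (rule ccontr)
    assume "c \<noteq> 0"
    have "AE t in ?M. t \<notin> E" using wc \<phi>E by eventually_elim (use \<open>c \<noteq> 0\<close> in \<open>auto simp: w_def\<close>)
    then have "AE t in lebesgue. t \<notin> E"
      using E(2) by (subst (asm) AE_restrict_space_iff) (auto elim!: eventually_mono)
    then show False using E by (simp add: AE_iff_null_sets null_setsD1)
  qed
  then have "AE t in ?M. \<phi> t = 0" using wc by (auto simp: w_def elim!: eventually_mono)
  then have "fourier \<phi> 0 = 0" unfolding fourier_def
    by (intro integral_eq_zero_AE) (auto elim!: eventually_mono)
  then show False using f0 by simp
qed

text \<open>A nonzero h has a first nonzero coefficient, of some index j \<ge> 0. Multiplication by
  e^{-ijt} moves it to index 0 without leaving H2 and without disturbing the zeros on E.\<close>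

theorem H2_uniqueness:
  assumes E: "E \<in> sets lebesgue" "E \<subseteq> circ" "emeasure lebesgue E > 0"
    and h: "H2 h" "AE x in lebesgue_on circ. x \<in> E \<longrightarrow> h x = 0"
  shows "AE x in lebesgue_on circ. h x = 0"
proof (rule fourier_uniqueness[OF H2_imp_integrable[OF h(1)]], rule ccontr)
  fix n assume "fourier h n \<noteq> 0"
  moreover have "n \<le> 0"
    using h(1) \<open>fourier h n \<noteq> 0\<close> by (meson H2_iff int_one_le_iff_zero_less linorder_not_le)
  ultimately have "\<exists>j. fourier h (- int j) \<noteq> 0" by (intro exI[of _ "nat (- n)"]) simp
  then obtain j where j: "fourier h (- int j) \<noteq> 0" and least: "\<And>i. i < j \<Longrightarrow> fourier h (- int i) = 0"
    using exists_least_iff[of "\<lambda>j. fourier h (- int j) \<noteq> 0"] by auto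
  \<comment> \<open>Because of the sign convention of \<open>fourier\<close>, the coefficient of
    index j is \<open>fourier h (- int j)\<close> up to 2 pi; dividing by it gives
    \<open>fourier \<phi> 0 = 1\<close>.\<close>
  define \<phi> where "\<phi> t = (1 / fourier h (- int j)) * (cis (of_int (- int j) * t) * h t)" for t
  have f\<phi>: "fourier \<phi> k = fourier h (k - int j) / fourier h (- int j)" for k
    unfolding \<phi>_def[abs_def] fourier_cmult fourier_shift by simp
  have "fourier h (k - int j) = 0" if "k \<ge> 1" for k
  proof (cases "k - int j \<ge> 1")
    case True
    then show ?thesis using h(1) by (simp add: H2_iff)
  next
    case False
    then have "k - int j = - int (nat (int j - k))" "nat (int j - k) < j" using that by auto
    then show ?thesis using least by metis
  qed
  moreover have "L2_on circ \<phi>"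
    unfolding \<phi>_def[abs_def] by (intro L2_on_cmult L2_on_cis_mult H2_imp_L2 h(1))
  ultimately have "H2 \<phi>" by (simp add: H2_iff f\<phi>)
  moreover have "AE x in lebesgue_on circ. x \<in> E \<longrightarrow> \<phi> x = 0"
    using h(2) by eventually_elim (simp add: \<phi>_def)
  ultimately have "fourier \<phi> 0 \<noteq> 1" by (rule H2_vanishing_mean[OF E])
  then show False using j by (simp add: f\<phi>)
qed

section \<open>The bounded extremal problem\<close>

lemma AE_lebesgue_on_subset:
  assumes "AE x in lebesgue_on F. P x" "E \<subseteq> F" "E \<in> sets lebesgue" "F \<in> sets lebesgue"
  shows "AE x in lebesgue_on E. P x"
  using assms by (auto simp: AE_restrict_space_iff elim!: eventually_mono)

lemma L2_sq_add_le:
  assumes "L2_on E g" "L2_on E h"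
  shows "L2_sq E (\<lambda>x. g x + h x) \<le> 2 * L2_sq E g + 2 * L2_sq E h"
  using L2_sq_parallelogram[OF assms] L2_sq_cmult[of E "1/2" "\<lambda>x. g x + h x"]
    L2_sq_nonneg[of E "\<lambda>x. g x - h x"]
  by (simp add: power2_eq_square del: L2_sq_nonneg)

lemma L2_sq_split:
  assumes "L2_on F h" "E \<subseteq> F" "E \<in> sets lebesgue" "F \<in> sets lebesgue"
  shows "L2_sq F h = L2_sq E h + L2_sq (F - E) h"
proof -
  have FE: "F - E \<in> sets lebesgue" "F - E \<subseteq> F" using assms by auto
  let ?q = "\<lambda>x. (cmod (h x))\<^sup>2"
  have i: "integrable (lebesgue_on F) (\<lambda>x. if x \<in> E then ?q x else 0)"
      "integrable (lebesgue_on F) (\<lambda>x. if x \<in> F - E then ?q x else 0)"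
    unfolding integrable_lebesgue_on_extend[OF assms(2-4)] integrable_lebesgue_on_extend[OF FE(2,1) assms(4)]
    using L2_on_integrable L2_on_subset[OF assms(1)] assms FE by auto
  have "L2_sq F h = integral\<^sup>L (lebesgue_on F) (\<lambda>x. (if x \<in> E then ?q x else 0) + (if x \<in> F - E then ?q x else 0))"
    unfolding L2_sq_def by (rule Bochner_Integration.integral_cong) auto
  also have "\<dots> = L2_sq E h + L2_sq (F - E) h"
    unfolding Bochner_Integration.integral_add[OF i] integral_lebesgue_on_extend[OF assms(2-4)]
      integral_lebesgue_on_extend[OF FE(2,1) assms(4)] L2_sq_def ..
  finally show ?thesis .
qed

section \<open>Admissible functions\<close>

lemma BEP_admissible_zero: "BEP_admissible J (\<lambda>x. 0)"
  by (simp add: BEP_admissible_def)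

lemma BEP_admissible_scale:
  assumes "BEP_admissible J g" "0 \<le> t" "t \<le> 1"
  shows "BEP_admissible J (\<lambda>x. of_real t * g x)"
proof -
  have "AE x in lebesgue. x \<in> J \<longrightarrow> cmod (g x) \<le> 1" using assms(1) by (simp add: BEP_admissible_def)
  then have "AE x in lebesgue. x \<in> J \<longrightarrow> cmod (of_real t * g x) \<le> 1"
    by eventually_elim (use assms(2,3) in \<open>auto simp: norm_mult intro: mult_le_one\<close>)
  then show ?thesis using assms(1) by (simp add: BEP_admissible_def H2_cmult)
qed

lemma BEP_admissible_mid:
  assumes "BEP_admissible J g" "BEP_admissible J h"
  shows "BEP_admissible J (\<lambda>x. (g x + h x) / 2)"
proof -
  have "AE x in lebesgue. x \<in> J \<longrightarrow> cmod (g x) \<le> 1" "AE x in lebesgue. x \<in> J \<longrightarrow> cmod (h x) \<le> 1"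
    using assms by (auto simp: BEP_admissible_def)
  then have "AE x in lebesgue. x \<in> J \<longrightarrow> cmod ((g x + h x) / 2) \<le> 1"
  proof eventually_elim
    case (elim x)
    show ?case using elim norm_triangle_ineq[of "g x" "h x"] by (auto simp: norm_divide)
  qed
  then show ?thesis using assms by (simp add: BEP_admissible_def H2_mid)
qed

text \<open>The objective controls g on I through f, and the constraint controls it on J. The sum
  bounds near-minimizers on the whole circle, as the limit lemma requires.\<close>

lemma L2_sq_BEP_bound:
  assumes I: "I \<in> sets lebesgue" "I \<subseteq> circ" and f: "L2_on I f" and g: "BEP_admissible (circ - I) g"
  shows "L2_sq circ g \<le> 2 * L2_sq I f + 2 * L2_sq I (\<lambda>x. f x - g x) + measure lebesgue (circ - I)"
proof -
  let ?J = "circ - I"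
  have J: "?J \<in> sets lebesgue" "?J \<subseteq> circ" using I by auto
  have Jm: "?J \<in> lmeasurable" using fmeasurable_Diff I circ_lmeasurable by blast
  have gL: "L2_on circ g" using g by (simp add: BEP_admissible_def H2_imp_L2)
  then have gI: "L2_on I g" and gJ: "L2_on ?J g" using L2_on_subset I J by auto
  have "L2_sq I g \<le> 2 * L2_sq I f + 2 * L2_sq I (\<lambda>x. f x - g x)"
    using L2_sq_add_le[OF f L2_on_cmult[OF L2_on_diff[OF f gI], of "-1"]]
      L2_sq_cmult[of I "-1" "\<lambda>x. f x - g x"] by simp
  moreover have "L2_sq ?J g \<le> integral\<^sup>L (lebesgue_on ?J) (\<lambda>x. 1)"
    unfolding L2_sq_def
  proof (rule integral_mono_AE)
    show "integrable (lebesgue_on ?J) (\<lambda>x. 1::real)"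
      using Jm by (simp add: finite_measure.integrable_const finite_measure_lebesgue_on)
    have "AE x in lebesgue. x \<in> ?J \<longrightarrow> cmod (g x) \<le> 1" using g by (simp add: BEP_admissible_def)
    then have "AE x in lebesgue_on ?J. cmod (g x) \<le> 1"
      using J by (subst AE_restrict_space_iff) auto
    then show "AE x in lebesgue_on ?J. (cmod (g x))\<^sup>2 \<le> 1"
      by eventually_elim (simp add: power_le_one)
  qed (rule L2_on_integrable[OF gJ])
  then have "L2_sq ?J g \<le> measure lebesgue ?J"
    using J by (simp add: measure_restrict_space)
  ultimately show ?thesis using L2_sq_split[OF gL I(2,1)] by simp
qed

text \<open>The limit lemma is applied to the sets of 1/(n+1)-near-minimizers. Its limit is in H2 by
  L2 convergence, satisfies the constraint by pointwise convergence, and attains the infimum by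
  Fatou on I.\<close>

lemma BEP_solution_exists:
  assumes I: "I \<in> sets lebesgue" "I \<subseteq> circ" and f: "L2_on I f"
  obtains g0 where "BEP_solution I f g0"
proof -
  let ?J = "circ - I"
  let ?M = "lebesgue_on circ"
  have J: "?J \<in> sets lebesgue" "?J \<subseteq> circ" using I by auto
  define d where "d g = L2_sq I (\<lambda>x. f x - g x)" for g
  define A where "A = {g. BEP_admissible ?J g}"
  define m where "m = Inf (d ` A)"
  define C where "C n = {g \<in> A. d g \<le> m + 1 / Suc n}" for n
  have A0: "A \<noteq> {}" using BEP_admissible_zero by (auto simp: A_def)
  have m_le: "m \<le> d g" if "g \<in> A" for g
    unfolding m_def using that by (intro cInf_lower) (auto intro!: bdd_belowI[of _ 0] simp: d_def)
  have AL: "L2_on circ g" if "g \<in> A" for g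
    using that by (simp add: A_def BEP_admissible_def H2_imp_L2)
  have AI: "L2_on I (\<lambda>x. f x - g x)" if "g \<in> A" for g
    using L2_on_diff[OF f L2_on_subset[OF AL[OF that] I(2,1)]] by simp
  obtain g0 g where g0: "L2_on circ g0" "\<And>n. g n \<in> C n" "AE x in ?M. (\<lambda>n. g n x) \<longlonglongrightarrow> g0 x"
    "(\<lambda>n. L2_sq circ (\<lambda>x. g n x - g0 x)) \<longlonglongrightarrow> 0"
  proof (rule decreasing_convex_limit_point[of circ C "2 * L2_sq I f + 2 * (m + 1) + measure lebesgue ?J"])
    show "L2_on circ g" if "g \<in> C n" for n g using that AL by (simp add: C_def)
    show "C (Suc n) \<subseteq> C n" for n
    proof -
      have "1 / real (Suc (Suc n)) \<le> 1 / Suc n" by (simp add: frac_le)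
      then show ?thesis by (auto simp: C_def simp del: of_nat_Suc)
    qed
    show "(\<lambda>x. (g1 x + g2 x) / 2) \<in> C n" if g: "g1 \<in> C n" "g2 \<in> C n" for n g1 g2
    proof -
      have gA: "g1 \<in> A" "g2 \<in> A" and le: "d g1 \<le> m + 1 / Suc n" "d g2 \<le> m + 1 / Suc n"
        using g by (auto simp: C_def)
      \<comment> \<open>The residual of a midpoint is the midpoint of the residuals, so the
        parallelogram law keeps near-minimality.\<close>
      have "f x - (g1 x + g2 x) / 2 = ((f x - g1 x) + (f x - g2 x)) / 2" for x
        by (simp add: field_simps)
      then have "d (\<lambda>x. (g1 x + g2 x) / 2) = L2_sq I (\<lambda>x. ((f x - g1 x) + (f x - g2 x)) / 2)"
        by (simp only: d_def)
      then have "d (\<lambda>x. (g1 x + g2 x) / 2) \<le> m + 1 / Suc n"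
        using L2_sq_parallelogram[OF AI[OF gA(1)] AI[OF gA(2)]] le
          L2_sq_nonneg[of I "\<lambda>x. (f x - g1 x) - (f x - g2 x)"] unfolding d_def by argo
      then show ?thesis using gA BEP_admissible_mid by (simp add: C_def A_def)
    qed
    show "\<exists>g\<in>C n. L2_sq circ g \<le> 2 * L2_sq I f + 2 * (m + 1) + measure lebesgue ?J" for n
    proof -
      have "\<exists>g\<in>A. d g < m + 1 / Suc n"
        using cInf_lessD[of "d ` A" "m + 1 / Suc n"] A0 by (auto simp: m_def)
      then obtain g where g: "g \<in> A" "d g < m + 1 / Suc n" by blast
      moreover from this have "d g \<le> m + 1"
        using le_divide_eq_1_pos[of "real (Suc n)" 1] by (smt (verit) divide_le_eq_1 of_nat_0_le_iff of_nat_Suc)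
      then have "L2_sq circ g \<le> 2 * L2_sq I f + 2 * (m + 1) + measure lebesgue ?J"
        using L2_sq_BEP_bound[OF I f, of g] g(1) by (simp add: A_def d_def)
      ultimately show ?thesis by (intro bexI[of _ g]) (auto simp: C_def)
    qed
  qed (rule circ_lmeasurable, rule that)
  have gA: "g n \<in> A" for n using g0(2)[of n] by (simp add: C_def)
  have H: "H2 g0"
    by (rule H2_limit[OF _ g0(1,4)]) (use gA in \<open>auto simp: A_def BEP_admissible_def\<close>)
  have "AE x in lebesgue. x \<in> ?J \<longrightarrow> cmod (g n x) \<le> 1" for n
    using gA by (simp add: A_def BEP_admissible_def)
  then have "AE x in lebesgue. \<forall>n. x \<in> ?J \<longrightarrow> cmod (g n x) \<le> 1"
    unfolding AE_all_countable by blast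
  moreover have "AE x in lebesgue. x \<in> circ \<longrightarrow> (\<lambda>n. g n x) \<longlonglongrightarrow> g0 x"
    using g0(3) by (subst (asm) AE_restrict_space_iff) auto
  ultimately have "AE x in lebesgue. x \<in> ?J \<longrightarrow> cmod (g0 x) \<le> 1"
  proof eventually_elim
    case (elim x)
    then show ?case by (auto intro: LIMSEQ_le_const2[OF tendsto_norm])
  qed
  with H have adm: "BEP_admissible ?J g0" by (simp add: BEP_admissible_def)
  have "AE x in lebesgue_on I. (\<lambda>n. g n x) \<longlonglongrightarrow> g0 x"
    by (rule AE_lebesgue_on_subset[OF g0(3) I(2,1)]) simp
  then have conv: "AE x in lebesgue_on I. (\<lambda>n. f x - g n x) \<longlonglongrightarrow> f x - g0 x"
    by eventually_elim (intro tendsto_intros)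
  have "(\<lambda>n. m + 1 / real (Suc n)) \<longlonglongrightarrow> m + 0"
    by (intro tendsto_intros LIMSEQ_Suc lim_1_over_n)
  moreover have "d (g n) \<le> m + 1 / Suc n" for n using g0(2)[of n] by (simp add: C_def)
  moreover have "g0 \<in> A" using adm by (simp add: A_def)
  ultimately have "d g0 \<le> m"
    using L2_fatou[OF AI[OF gA] L2_on_measurable[OF AI] conv, of "\<lambda>n. m + 1 / Suc n" m]
    unfolding d_def by simp
  then have "BEP_solution I f g0"
    using adm m_le by (fastforce simp: BEP_solution_def L2_norm_le_iff A_def d_def)
  then show ?thesis by (rule that)
qed

lemma BEP_solution_unique:
  assumes I: "I \<in> sets lebesgue" "I \<subseteq> circ" "emeasure lebesgue I > 0" and f: "L2_on I f"
    and g0: "BEP_solution I f g0" and g1: "BEP_solution I f g1"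
  shows "AE x in lebesgue_on circ. g1 x = g0 x"
proof -
  have adm: "BEP_admissible (circ - I) g0" "BEP_admissible (circ - I) g1"
    using g0 g1 by (auto simp: BEP_solution_def)
  then have H: "H2 g0" "H2 g1" by (auto simp: BEP_admissible_def)
  have L: "L2_on I g0" "L2_on I g1"
    using H[THEN H2_imp_L2, THEN L2_on_subset, OF I(2,1)] by auto
  let ?a = "\<lambda>x. f x - g0 x" and ?b = "\<lambda>x. f x - g1 x"
  have eq: "L2_sq I ?b = L2_sq I ?a"
    using g0 g1 by (intro antisym) (auto simp: BEP_solution_def L2_norm_le_iff)
  have "L2_sq I ?a \<le> L2_sq I (\<lambda>x. f x - (g0 x + g1 x) / 2)"
    using g0 BEP_admissible_mid[OF adm] by (auto simp: BEP_solution_def L2_norm_le_iff)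
  moreover have "f x - (g0 x + g1 x) / 2 = (?a x + ?b x) / 2" for x by (simp add: field_simps)
  ultimately have "L2_sq I ?a \<le> L2_sq I (\<lambda>x. (?a x + ?b x) / 2)" by (simp only:)
  \<comment> \<open>The two residuals have equal norm and their midpoint is no shorter, so the
    parallelogram law leaves nothing for their difference.\<close>
  then have "L2_sq I (\<lambda>x. ?a x - ?b x) \<le> 0"
    using L2_sq_parallelogram[OF L2_on_diff[OF f L(1)] L2_on_diff[OF f L(2)]] eq by argo
  moreover have "?a x - ?b x = g1 x - g0 x" for x by simp
  ultimately have "L2_sq I (\<lambda>x. g1 x - g0 x) = 0"
    using L2_sq_nonneg[of I "\<lambda>x. g1 x - g0 x"] by simp
  then have "AE x in lebesgue_on I. g1 x - g0 x = 0"
    using L2_sq_eq_0_iff[OF L2_on_diff[OF L(2,1)]] by blast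
  then have "AE x in lebesgue_on circ. x \<in> I \<longrightarrow> g1 x - g0 x = 0"
    using I by (auto simp: AE_restrict_space_iff elim!: eventually_mono)
  then have "AE x in lebesgue_on circ. g1 x - g0 x = 0"
    by (rule H2_uniqueness[OF I H2_diff[OF H(2,1)]])
  then show ?thesis by simp
qed

text \<open>The functions (1 - t) g0 are admissible, so shrinking g0 cannot improve the fit. This
  makes the real part r of the inner product of f - g0 with g0 nonnegative, and in the expansion of
  the squared norm of f = (f - g0) + g0 every term besides that of g0 is then nonnegative.\<close>

lemma BEP_solution_norm_le:
  assumes I: "I \<in> sets lebesgue" "I \<subseteq> circ" and f: "L2_on I f" and g0: "BEP_solution I f g0"
  shows "L2_sq I g0 \<le> L2_sq I f"
proof -
  have adm: "BEP_admissible (circ - I) g0" using g0 by (simp add: BEP_solution_def)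
  then have L: "L2_on I g0"
    using L2_on_subset[OF H2_imp_L2 I(2,1)] by (simp add: BEP_admissible_def)
  let ?a = "\<lambda>x. f x - g0 x"
  have a: "L2_on I ?a" using L2_on_diff[OF f L] .
  define r where "r = Re (integral\<^sup>L (lebesgue_on I) (\<lambda>x. ?a x * cnj (g0 x)))"
  define s where "s = L2_sq I g0"
  have s: "s \<ge> 0" by (simp add: s_def)
  \<comment> \<open>Minimality along the segment, expanded in t and divided by t. Only t > 0 is
    available, so the conclusion is an inequality for r.\<close>
  have key: "0 \<le> 2 * r + t * s" if t: "0 < t" "t \<le> 1" for t
  proof -
    have "BEP_admissible (circ - I) (\<lambda>x. of_real (1 - t) * g0 x)"
      using BEP_admissible_scale[OF adm, of "1 - t"] t by simp
    then have "L2_sq I ?a \<le> L2_sq I (\<lambda>x. f x - of_real (1 - t) * g0 x)"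
      using g0 by (simp add: BEP_solution_def L2_norm_le_iff)
    moreover have "f x - of_real (1 - t) * g0 x = ?a x + of_real t * g0 x" for x
      by (simp add: algebra_simps)
    ultimately have "L2_sq I ?a \<le> L2_sq I (\<lambda>x. ?a x + of_real t * g0 x)" by (simp only:)
    also have "?a x * cnj (of_real t * g0 x) = of_real t * (?a x * cnj (g0 x))" for x by simp
    then have "L2_sq I (\<lambda>x. ?a x + of_real t * g0 x) = L2_sq I ?a + 2 * (t * r) + t\<^sup>2 * s"
      unfolding L2_sq_add[OF a L2_on_cmult[OF L]] L2_sq_cmult
      by (simp only: integral_mult_right_zero) (simp add: r_def s_def)
    finally have "0 \<le> t * (2 * r + t * s)" by (simp add: algebra_simps power2_eq_square)
    then show ?thesis using t by (simp add: zero_le_mult_iff)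
  qed
  have "r \<ge> 0"
  proof (rule ccontr)
    assume "\<not> r \<ge> 0"
    then have r: "r < 0" by simp
    \<comment> \<open>With this t one has t s \<le> -r, so 2 r + t s \<le> r < 0 contradicts
      \<open>key\<close>.\<close>
    define t where "t = min 1 (- r / (s + 1))"
    have t: "0 < t" "t \<le> 1" using r s by (auto simp: t_def field_simps)
    have "t * s \<le> - r / (s + 1) * s" using s by (intro mult_right_mono) (auto simp: t_def)
    also have "\<dots> \<le> - r" using r s by (simp add: field_simps)
    finally show False using key[OF t] r by linarith
  qed
  moreover have "L2_sq I f = L2_sq I ?a + 2 * r + s"
    using L2_sq_add[OF a L] by (simp add: r_def s_def)
  ultimately show ?thesis using L2_sq_nonneg[of I ?a] by (simp add: s_def)
qed

text \<open>Slack in the constraint frees small complex multiples of each e^{int} in all directions,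
  so the first variation is an equality. Conjugating the resulting orthogonality on I gives the
  integrals of conj(f - g0) e^{int}, that is, the coefficients that H2 requires to vanish. The
  uniqueness theorem is then used with J as the zero set.\<close>

lemma BEP_solution_unsaturated:
  assumes I: "I \<in> sets lebesgue" "I \<subseteq> circ" and J: "emeasure lebesgue (circ - I) > 0"
    and f: "L2_on I f" and g0: "BEP_solution I f g0" and less: "Linf_norm (circ - I) g0 < 1"
  shows "AE x in lebesgue. x \<in> I \<longrightarrow> f x = g0 x"
proof -
  have H: "H2 g0" using g0 by (simp add: BEP_solution_def BEP_admissible_def)
  then have L: "L2_on I g0" using L2_on_subset[OF H2_imp_L2 I(2,1)] by simp
  obtain c where c: "c < 1" "AE x in lebesgue. x \<in> circ - I \<longrightarrow> ereal (cmod (g0 x)) \<le> c"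
    using less unfolding Linf_norm_def Inf_less_iff by blast
  \<comment> \<open>The bound c is an extended real; a real r between c and 1 provides the
    admissible radius 1 - r.\<close>
  then obtain r where r: "c < ereal r" "ereal r < 1" using ereal_dense2 by blast
  let ?a = "\<lambda>x. f x - g0 x"
  have a: "L2_on I ?a" using L2_on_diff[OF f L] .
  have H1: "H2 (\<lambda>t. cis (of_int n * t))" if "n \<ge> 0" for n
    using H2_cis_mult[OF _ that, of "\<lambda>t. 1"] by (simp add: H2_iff L2_on_const fourier_one)
  have orth: "integral\<^sup>L (lebesgue_on I) (\<lambda>x. ?a x * cnj (cis (of_int n * x))) = 0" if n: "n \<ge> 0" for n
  proof (rule L2_sq_min_orthogonal[OF a])
    show "L2_on I (\<lambda>t. cis (of_int n * t))" using L2_on_subset[OF H2_imp_L2[OF H1[OF n]] I(2,1)] by simp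
    show "1 - r > 0" using r by simp
    fix e assume e: "cmod e \<le> 1 - r"
    \<comment> \<open>The perturbation is subtracted from g0 so that it is added to the residual, as
      in \<open>L2_sq_min_orthogonal\<close>.\<close>
    have "AE x in lebesgue. x \<in> circ - I \<longrightarrow> cmod (g0 x - e * cis (of_int n * x)) \<le> 1"
      using c(2)
    proof eventually_elim
      case (elim x)
      show ?case
      proof
        assume "x \<in> circ - I"
        with elim have "ereal (cmod (g0 x)) < ereal r" using r(1) by (meson le_less_trans)
        then show "cmod (g0 x - e * cis (of_int n * x)) \<le> 1"
          using norm_triangle_ineq4[of "g0 x" "e * cis (of_int n * x)"] e by (simp add: norm_mult)
      qed
    qed
    then have "BEP_admissible (circ - I) (\<lambda>x. g0 x - e * cis (of_int n * x))"
      by (simp add: BEP_admissible_def H2_diff H H2_cmult H1 n)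
    then have "L2_sq I ?a \<le> L2_sq I (\<lambda>x. f x - (g0 x - e * cis (of_int n * x)))"
      using g0 by (simp add: BEP_solution_def L2_norm_le_iff)
    then show "L2_sq I ?a \<le> L2_sq I (\<lambda>x. ?a x + e * cis (of_int n * x))"
      by (simp add: algebra_simps)
  qed
  define u where "u x = (if x \<in> I then cnj (?a x) else 0)" for x
  have "L2_on circ u"
    unfolding u_def[abs_def] by (rule L2_on_extend[OF L2_on_cnj[OF a] I(2,1)]) simp
  moreover have "fourier u n = 0" if "n \<ge> 0" for n
  proof -
    have "u x * cis (of_int n * x) = (if x \<in> I then cnj (?a x * cnj (cis (of_int n * x))) else 0)" for x
      by (simp add: u_def)
    then have "fourier u n = integral\<^sup>L (lebesgue_on I) (\<lambda>x. cnj (?a x * cnj (cis (of_int n * x))))"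
      unfolding fourier_def using integral_lebesgue_on_extend[OF I(2,1) circ_sets] by (simp only:)
    then show ?thesis using orth[OF that] by (simp only: Bochner_Integration.integral_cnj complex_cnj_zero)
  qed
  ultimately have "H2 u" by (simp add: H2_iff)
  moreover have "AE x in lebesgue_on circ. x \<in> circ - I \<longrightarrow> u x = 0" by (simp add: u_def)
  ultimately have "AE x in lebesgue_on circ. u x = 0"
    using I by (intro H2_uniqueness[OF _ _ J]) auto
  then have "AE x in lebesgue_on I. u x = 0" by (rule AE_lebesgue_on_subset[OF _ I(2,1)]) simp
  then have "AE x in lebesgue. x \<in> I \<longrightarrow> u x = 0"
    using I by (subst (asm) AE_restrict_space_iff) auto
  then show ?thesis by eventually_elim (auto simp: u_def)
qed

theorem mainTheorem2:
  fixes I :: "real set" and f :: "real \<Rightarrow> complex"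
  assumes "I \<in> sets lebesgue" and "I \<subseteq> circ"
    and "emeasure lebesgue I > 0" and "emeasure lebesgue (circ - I) > 0"
    and "L2_on I f"
  shows "\<exists>g0. BEP_solution I f g0
           \<and> (\<forall>g1. BEP_solution I f g1 \<longrightarrow> (AE x in lebesgue_on circ. g1 x = g0 x))
           \<and> L2_norm I g0 \<le> L2_norm I f
           \<and> ((\<nexists>g. H2 g \<and> (AE x in lebesgue. x \<in> I \<longrightarrow> f x = g x)
                    \<and> Linf_norm (circ - I) g < 1)
              \<longrightarrow> Linf_norm (circ - I) g0 = 1)"
proof -
  obtain g0 where g0: "BEP_solution I f g0"
    using BEP_solution_exists[OF assms(1,2,5)] .
  then have adm: "BEP_admissible (circ - I) g0" by (simp add: BEP_solution_def)
  then have "Linf_norm (circ - I) g0 \<le> 1"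
    unfolding Linf_norm_def by (intro Inf_lower) (simp add: BEP_admissible_def one_ereal_def)
  \<comment> \<open>The last clause is proved by contraposition: if the norm of g0 on J were below
    1, g0 itself would be the exceptional g.\<close>
  moreover have "\<exists>g. H2 g \<and> (AE x in lebesgue. x \<in> I \<longrightarrow> f x = g x) \<and> Linf_norm (circ - I) g < 1"
    if "Linf_norm (circ - I) g0 < 1"
    using BEP_solution_unsaturated[OF assms(1,2,4,5) g0 that] adm that
    by (auto simp: BEP_admissible_def)
  ultimately show ?thesis
    using g0 BEP_solution_unique[OF assms(1-3,5) g0] BEP_solution_norm_le[OF assms(1,2,5) g0]
    by (intro exI[of _ g0]) (auto simp: L2_norm_le_iff less_le)
qed

end
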